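(* Let $\mathsf{A}(t',t)=\widetilde{\mathsf{A}}(t')\Theta(t'-t)$ be an $N\times N$ complex time-dependent matrix with entries in $\mathrm{Sm}_\Theta(I)$, let $\boldsymbol{v},\boldsymbol{w}\in\mathbb{C}^N$ be time-independent vectors with $\boldsymbol{w}^H\boldsymbol{v}=1$, and let $1\le n\le N$. Assume that the $\ast$-Lanczos algorithm run on $(\mathsf{A},\boldsymbol{w},\boldsymbol{v})$ satisfies the no-breakdown assumption for the coefficients $\beta_1,\dots,\beta_{n-1}$, and let $\mathsf{T}_n$ be the $n\times n$ tridiagonal matrix it produces. Then $$\boldsymbol{w}^H(\mathsf{A}^{\ast j})\,\boldsymbol{v}=\boldsymbol{e}_1^H(\mathsf{T}_n^{\ast j})\,\boldsymbol{e}_1\qquad\text{for } j=0,\dots,2n-1 .$$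
   Context: Let $I\subseteq\mathbb{R}$ be an interval and $t',t$ real variables in $I$. Distributions and the $\ast$-product. $\mathrm{D}(I)$ is the class of distributions of the form $d(t',t)=\widetilde d(t',t)\Theta(t'-t)+\sum_{i=0}^{M}\widetilde d_i(t',t)\delta^{(i)}(t'-t)$ with $M$ finite and $\widetilde d,\widetilde d_i$ smooth functions on $I^2$; $\Theta$ is the Heaviside function with $\Theta(0)=1$ and $\delta^{(i)}$ is the $i$-th derivative of the Dirac delta. $\mathrm{Sm}_\Theta(I)\subset \mathrm{D}(I)$ is the subclass of those of the form $\widetilde f(t',t)\Theta(t'-t)$. The (non-commutative, associative) $\ast$-product on $\mathrm{D}(I)$ is $(f_2\ast f_1)(t',t)=\int_{-\infty}^{\infty}f_2(t',\tau)f_1(\tau,t)\,d\tau$ (in the sense of distributions); on $\mathrm{Sm}_\Theta(I)$ it equals $\Theta(t'-t)\int_t^{t'}\widetilde f_2(t',\tau)\widetilde f_1(\tau,t)\,d\tau$. For $f(t',t)=\widetilde f(t',t)\Theta(t'-t)$ one has $f\ast\delta'=-(\partial_t\widetilde f)\Theta(t'-t)+\widetilde f(t',t')\delta(t'-t)$ and $\delta'\ast f=(\partial_{t'}\widetilde f)\Theta(t'-t)+\widetilde f(t,t)\delta(t'-t)$, and $\delta^{(i)}\ast\delta^{(j)}=\delta^{(i+j)}$. The identity is $1_\ast=\delta(t'-t)$. The product extends to matrices and vectors with entries in $\mathrm{D}(I)$ by the usual row-by-column rule, with identity $\mathrm{Id}_\ast=\mathrm{Id}\,1_\ast$; $\mathsf{M}^{\ast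 j}$ is the $j$-th $\ast$-power, with $\mathsf{M}^{\ast 0}=\mathrm{Id}_\ast$. When no product symbol is written between a time-independent vector and a matrix, it is the usual matrix-vector product. The $\ast$-inverse $f^{\ast-1}$ satisfies $f^{\ast-1}\ast f=f\ast f^{\ast-1}=1_\ast$. The $\ast$-Lanczos algorithm. Input: $\mathsf{A},\boldsymbol{w},\boldsymbol{v}$. Set $\boldsymbol{v}_{-1}=\boldsymbol{w}_{-1}=0$, $\boldsymbol{v}_0=\boldsymbol{v}\,1_\ast$, $\boldsymbol{w}_0^H=\boldsymbol{w}^H1_\ast$. For $k=1,2,\dots$ define $$\alpha_{k-1}=\boldsymbol{w}_{k-1}^H\ast\mathsf{A}\ast\boldsymbol{v}_{k-1},\qquad \boldsymbol{w}_k^H=\boldsymbol{w}_{k-1}^H\ast\mathsf{A}-\alpha_{k-1}\ast\boldsymbol{w}_{k-1}^H-\beta_{k-1}\ast\boldsymbol{w}_{k-2}^H,$$ $$\widehat{\boldsymbol{v}}_k=\mathsf{A}\ast\boldsymbol{v}_{k-1}-\boldsymbol{v}_{k-1}\ast\alpha_{k-1}-\boldsymbol{v}_{k-2},\qquad \beta_k=\boldsymbol{w}_k^H\ast\mathsf{A}\ast\boldsymbol{v}_{k-1},\qquad \boldsymbol{v}_k=\widehat{\boldsymbol{v}}_k\ast\beta_k^{\ast-1},$$ where for $k=1$ the terms with index $-1$ are absent. (Here $\boldsymbol{w}_k^H$ denotes a row vector of distributions.) The matrix $\mathsf{T}_n$ is the $n\times n$ tridiagonal matrix with diagonal entries $\alpha_0,\dots,\alpha_{n-1}$,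 all superdiagonal entries equal to $1_\ast$, and subdiagonal entries $\beta_1,\dots,\beta_{n-1}$. No-breakdown assumption for $\beta_1,\dots,\beta_{n-1}$: each $\beta_j$, $1\le j\le n-1$, is $\ast$-invertible, with inverse in $\mathrm{D}(I)$, and $\beta_j^{(1,0)}(t,t)\neq0$ for every $t\in I$, where $\beta_j^{(1,0)}(t',t)=\frac{\partial}{\partial t}\beta_j(t',t)$ (the derivative being taken of the smooth coefficient of $\Theta(t'-t)$; it is known that under this condition all coefficients involved lie in $\mathrm{Sm}_\Theta(I)$). $\boldsymbol{e}_1$ is the first canonical basis vector. *)

theory Defs
  imports "HOL-Analysis.Analysis" "HOL-Library.Function_Algebras"
begin

section \<open>Smooth functions on an interval and on its square\<close>

text \<open>All derivatives are taken within \<open>I\<close>, hence one-sided at end points belonging to \<open>I\<close>.\<close>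

definition deriv_on :: "real set \<Rightarrow> (real \<Rightarrow> complex) \<Rightarrow> real \<Rightarrow> complex" where
  "deriv_on I f t = vector_derivative f (at t within I)"

definition smooth_on :: "real set \<Rightarrow> (real \<Rightarrow> complex) \<Rightarrow> bool" where
  "smooth_on I f \<longleftrightarrow> (\<forall>k. \<forall>t\<in>I. (deriv_on I ^^ k) f differentiable (at t within I))"

text \<open>Functions of two variables are written \<open>f t' t\<close>; \<open>pd1\<close> is the partial derivative in
  \<open>t'\<close> and \<open>pd2\<close> the one in \<open>t\<close>.\<close>

definition pd1 :: "real set \<Rightarrow> (real \<Rightarrow> real \<Rightarrow> complex) \<Rightarrow> real \<Rightarrow> real \<Rightarrow> complex" where
  "pd1 I f t' t = deriv_on I (\<lambda>x. f x t) t'"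

definition pd2 :: "real set \<Rightarrow> (real \<Rightarrow> real \<Rightarrow> complex) \<Rightarrow> real \<Rightarrow> real \<Rightarrow> complex" where
  "pd2 I f t' t = deriv_on I (\<lambda>x. f t' x) t"

definition smooth2_on :: "real set \<Rightarrow> (real \<Rightarrow> real \<Rightarrow> complex) \<Rightarrow> bool" where
  "smooth2_on I f \<longleftrightarrow>
     (\<forall>i j. let g = (pd1 I ^^ i) ((pd2 I ^^ j) f) in
        continuous_on (I \<times> I) (\<lambda>(t', t). g t' t) \<and>
        (\<forall>t'\<in>I. \<forall>t\<in>I. (\<lambda>x. g x t) differentiable (at t' within I) \<and>
                        (\<lambda>x. g t' x) differentiable (at t within I)))"

section \<open>Distributions and the star product\<close>

text \<open>A distribution \<open>d(t',t)\<close> is a distribution in \<open>t\<close> depending on the parameter \<open>t'\<close>: it is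
  given by its pairings \<open>d t' \<phi> = \<integral> d(t',t) \<phi>(t) dt\<close> with test functions \<open>\<phi>\<close> on \<open>I\<close>. As all
  distributions considered are supported in \<open>t \<le> t'\<close>, it suffices that a test function vanishes
  near the left end of \<open>I\<close>; no support condition is needed at the right end. By convention the
  pairing is \<open>0\<close> if \<open>t' \<notin> I\<close> or \<open>\<phi>\<close> is not a test function, so that equality of distributions is
  equality in HOL. Sums and differences are the pointwise ones.\<close>

type_synonym distr = "real \<Rightarrow> (real \<Rightarrow> complex) \<Rightarrow> complex"

definition test_fun :: "real set \<Rightarrow> (real \<Rightarrow> complex) \<Rightarrow> bool" where
  "test_fun I \<phi> \<longleftrightarrow> smooth_on I \<phi> \<and> (\<exists>c\<in>interior I. \<forall>t\<in>I. t \<le> c \<longrightarrow> \<phi> t = 0)"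

definition distr_on :: "real set \<Rightarrow> distr \<Rightarrow> distr" where
  "distr_on I d = (\<lambda>t' \<phi>. if t' \<in> I \<and> test_fun I \<phi> then d t' \<phi> else 0)"

definition Heaviside :: "real \<Rightarrow> complex" where
  "Heaviside x = (if 0 \<le> x then 1 else 0)"

text \<open>The distribution \<open>f(t',t) \<Theta>(t'-t)\<close>.\<close>

definition theta_distr :: "real set \<Rightarrow> (real \<Rightarrow> real \<Rightarrow> complex) \<Rightarrow> distr" where
  "theta_distr I f = distr_on I (\<lambda>t' \<phi>. integral I (\<lambda>t. f t' t * Heaviside (t' - t) * \<phi> t))"

text \<open>The distribution \<open>f(t',t) \<delta>\<^sup>(\<^sup>i\<^sup>)(t'-t)\<close>. Since \<open>\<delta>\<^sup>(\<^sup>i\<^sup>)(t'-t) = (-\<partial>\<^sub>t)\<^sup>i \<delta>(t'-t)\<close>, moving the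
  derivatives to the other factor cancels the signs:
  \<open>\<integral> f(t',t) \<delta>\<^sup>(\<^sup>i\<^sup>)(t'-t) \<phi>(t) dt\<close> is \<open>\<partial>\<^sub>t\<^sup>i (f(t',t) \<phi>(t))\<close> at \<open>t = t'\<close>.\<close>

definition delta_distr :: "real set \<Rightarrow> nat \<Rightarrow> (real \<Rightarrow> real \<Rightarrow> complex) \<Rightarrow> distr" where
  "delta_distr I i f = distr_on I (\<lambda>t' \<phi>. (deriv_on I ^^ i) (\<lambda>t. f t' t * \<phi> t) t')"

definition Sm_Theta :: "real set \<Rightarrow> distr set" where
  "Sm_Theta I = {theta_distr I f | f. smooth2_on I f}"

text \<open>\<open>has_theta_coeff I d f\<close>: \<open>d\<close> belongs to the class \<open>D(I)\<close>, and \<open>f\<close> is a smooth coefficient of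
  \<open>\<Theta>(t'-t)\<close> in \<open>d\<close> (unique for \<open>t \<le> t'\<close> only).\<close>

definition has_theta_coeff :: "real set \<Rightarrow> distr \<Rightarrow> (real \<Rightarrow> real \<Rightarrow> complex) \<Rightarrow> bool" where
  "has_theta_coeff I d f \<longleftrightarrow> smooth2_on I f \<and>
     (\<exists>(M::nat) c. (\<forall>i\<le>M. smooth2_on I (c i)) \<and>
        d = theta_distr I f + (\<Sum>i\<le>M. delta_distr I i (c i)))"

definition DI :: "real set \<Rightarrow> distr set" where
  "DI I = {d. \<exists>f. has_theta_coeff I d f}"

text \<open>\<open>(f\<^sub>2 * f\<^sub>1)(t',t) = \<integral> f\<^sub>2(t',\<tau>) f\<^sub>1(\<tau>,t) d\<tau>\<close>, paired with \<open>\<phi>(t)\<close>, is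
  \<open>\<integral> f\<^sub>2(t',\<tau>) (\<integral> f\<^sub>1(\<tau>,t) \<phi>(t) dt) d\<tau>\<close>.\<close>

definition star :: "distr \<Rightarrow> distr \<Rightarrow> distr" (infixl "\<star>" 70) where
  "f2 \<star> f1 = (\<lambda>t' \<phi>. f2 t' (\<lambda>\<tau>. f1 \<tau> \<phi>))"

definition star_one :: "real set \<Rightarrow> distr" where
  "star_one I = delta_distr I 0 (\<lambda>_ _. 1)"

definition is_star_inverse :: "real set \<Rightarrow> distr \<Rightarrow> distr \<Rightarrow> bool" where
  "is_star_inverse I f g \<longleftrightarrow> g \<in> DI I \<and> g \<star> f = star_one I \<and> f \<star> g = star_one I"

definition star_inv :: "real set \<Rightarrow> distr \<Rightarrow> distr" where
  "star_inv I f = (THE g. is_star_inverse I f g)"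

definition cscale :: "complex \<Rightarrow> distr \<Rightarrow> distr" where
  "cscale a d = (\<lambda>t' \<phi>. a * d t' \<phi>)"

section \<open>Vectors and matrices of distributions\<close>

text \<open>Vectors and matrices are functions on a finite index set \<open>K\<close>; their values outside \<open>K\<close> are
  irrelevant.\<close>

type_synonym 'k dvec = "'k \<Rightarrow> distr"
type_synonym 'k dmat = "'k \<Rightarrow> 'k \<Rightarrow> distr"

definition row_col :: "'k set \<Rightarrow> 'k dvec \<Rightarrow> 'k dvec \<Rightarrow> distr" where
  "row_col K x y = (\<Sum>i\<in>K. x i \<star> y i)"

definition row_mat :: "'k set \<Rightarrow> 'k dvec \<Rightarrow> 'k dmat \<Rightarrow> 'k dvec" where
  "row_mat K x M = (\<lambda>j. \<Sum>i\<in>K. x i \<star> M i j)"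

definition mat_col :: "'k set \<Rightarrow> 'k dmat \<Rightarrow> 'k dvec \<Rightarrow> 'k dvec" where
  "mat_col K M y = (\<lambda>i. \<Sum>j\<in>K. M i j \<star> y j)"

definition mat_mat :: "'k set \<Rightarrow> 'k dmat \<Rightarrow> 'k dmat \<Rightarrow> 'k dmat" where
  "mat_mat K M P = (\<lambda>i j. \<Sum>k\<in>K. M i k \<star> P k j)"

definition mat_one :: "real set \<Rightarrow> 'k dmat" where
  "mat_one I = (\<lambda>i j. if i = j then star_one I else 0)"

primrec mat_power :: "real set \<Rightarrow> 'k set \<Rightarrow> 'k dmat \<Rightarrow> nat \<Rightarrow> 'k dmat" where
  "mat_power I K M 0 = mat_one I"
| "mat_power I K M (Suc j) = mat_mat K (mat_power I K M j) M"

text \<open>\<open>w\<^sup>H M v\<close> for constant vectors \<open>w\<close>, \<open>v\<close>, with the usual matrix-vector products.\<close>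

definition const_form :: "'k set \<Rightarrow> ('k \<Rightarrow> complex) \<Rightarrow> 'k dmat \<Rightarrow> ('k \<Rightarrow> complex) \<Rightarrow> distr" where
  "const_form K w M v = (\<Sum>i\<in>K. \<Sum>j\<in>K. cscale (cnj (w i) * v j) (M i j))"

definition theta_mat :: "real set \<Rightarrow> (real \<Rightarrow> complex^'n^'n) \<Rightarrow> 'n dmat" where
  "theta_mat I At = (\<lambda>i j. theta_distr I (\<lambda>t' t. At t' $ i $ j))"

section \<open>The star-Lanczos algorithm\<close>

text \<open>\<open>lanczos_w k\<close> is the row vector \<open>w\<^sub>k\<^sup>H\<close> and \<open>lanczos_v k\<close> the column vector \<open>v\<^sub>k\<close>. In the
  step from \<open>k\<close> to \<open>k+1\<close> the terms with index \<open>-1\<close> are absent for \<open>k = 0\<close>.\<close>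

context
  fixes I :: "real set" and A :: "'n::finite dmat" and w v :: "complex^'n"
begin

fun lanczos_w :: "nat \<Rightarrow> 'n dvec" and lanczos_v :: "nat \<Rightarrow> 'n dvec" where
  "lanczos_w 0 = (\<lambda>i. cscale (cnj (w $ i)) (star_one I))"
| "lanczos_v 0 = (\<lambda>i. cscale (v $ i) (star_one I))"
| "lanczos_w (Suc k) =
     (let \<alpha> = row_col UNIV (row_mat UNIV (lanczos_w k) A) (lanczos_v k);
          \<beta> = row_col UNIV (row_mat UNIV (lanczos_w k) A) (lanczos_v (k - 1))
      in row_mat UNIV (lanczos_w k) A
         - (\<lambda>i. \<alpha> \<star> lanczos_w k i)
         - (if k = 0 then 0 else (\<lambda>i. \<beta> \<star> lanczos_w (k - 1) i)))"
| "lanczos_v (Suc k) =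
     (let \<alpha> = row_col UNIV (row_mat UNIV (lanczos_w k) A) (lanczos_v k);
          v_hat = mat_col UNIV A (lanczos_v k)
            - (\<lambda>i. lanczos_v k i \<star> \<alpha>)
            - (if k = 0 then 0 else lanczos_v (k - 1));
          \<beta> = row_col UNIV (row_mat UNIV (lanczos_w (Suc k)) A) (lanczos_v k)
      in (\<lambda>i. v_hat i \<star> star_inv I \<beta>))"

definition lanczos_alpha :: "nat \<Rightarrow> distr" where
  "lanczos_alpha k = row_col UNIV (row_mat UNIV (lanczos_w k) A) (lanczos_v k)"

text \<open>Meaningful for \<open>k \<ge> 1\<close> only.\<close>

definition lanczos_beta :: "nat \<Rightarrow> distr" where
  "lanczos_beta k = row_col UNIV (row_mat UNIV (lanczos_w k) A) (lanczos_v (k - 1))"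

text \<open>Rows and columns are numbered from \<open>0\<close>.\<close>

definition lanczos_T :: "nat dmat" where
  "lanczos_T i j =
     (if i = j then lanczos_alpha i
      else if j = Suc i then star_one I
      else if i = Suc j then lanczos_beta i
      else 0)"

definition no_breakdown :: "nat \<Rightarrow> bool" where
  "no_breakdown n \<longleftrightarrow>
     (\<forall>j\<in>{1..n - 1}.
        (\<exists>g. is_star_inverse I (lanczos_beta j) g) \<and>
        (\<exists>b. has_theta_coeff I (lanczos_beta j) b \<and> (\<forall>t\<in>I. pd2 I b t t \<noteq> 0)))"

end

end

theory Submission
  imports Defs
begin

text \<open>
  A distribution \<open>d(t',t)\<close> is an operator: it sends a test function \<open>\<phi>\<close> to the function
  \<open>t' \<mapsto> \<integral> d(t',t) \<phi>(t) dt\<close>, and the star product is the composition of operators. Associativity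
  is then immediate. Left distributivity \<open>f \<star> (g + h) = f \<star> g + f \<star> h\<close>, however, needs \<open>f\<close> to be
  linear on the functions that \<open>g\<close> and \<open>h\<close> produce, and \<open>1\<^sub>\<star>\<close> is neutral only for operators that
  turn test functions into test functions. The analytic part shows that every distribution in
  \<open>D(I)\<close> is such an operator (\<open>test_operator\<close>). For \<open>f(t',t) \<Theta>(t'-t)\<close> this is the differentiation of
  a parameter integral with variable upper limit, for \<open>f(t',t) \<delta>\<^sup>(\<^sup>i\<^sup>)(t'-t)\<close> it is the product rule;
  in both cases one needs that \<open>t \<mapsto> f(t,t)\<close> is smooth, which rests on the symmetry of second
  derivatives. Test operators form an associative ring with unit, where star inverses are unique,
  so that the coefficients of the algorithm can be manipulated as in noncommutative algebra.

  In this ring the theorem is the moment matching property of the nonsymmetric Lanczos process.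
  The three-term recurrences yield biorthogonality \<open>w\<^sub>i\<^sup>H \<star> v\<^sub>j = \<delta>\<^sub>i\<^sub>j 1\<^sub>\<star>\<close> for \<open>i, j < n\<close>
  (\<open>biorthogonality\<close>). Let \<open>W\<close> be the matrix with rows \<open>w\<^sub>0\<^sup>H, \<dots>, w\<^sub>n\<^sub>-\<^sub>1\<^sup>H\<close> and \<open>V\<close> the one with
  columns \<open>v\<^sub>0, \<dots>, v\<^sub>n\<^sub>-\<^sub>1\<close>; then \<open>W V = 1\<close>, \<open>W A V = T\<close>, and \<open>W A = T W\<close>, \<open>A V = V T\<close> except
  for the last row and the last column respectively. As \<open>T\<close> is tridiagonal, the first row of
  \<open>T\<^sup>i\<close> does not reach the last position before \<open>i = n - 1\<close>, so the exceptional row is not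
  noticed and \<open>e\<^sub>1\<^sup>H T\<^sup>i W = w\<^sup>H A\<^sup>i\<close> for \<open>i < n\<close> (\<open>row_moments\<close>); likewise
  \<open>V T\<^sup>l e\<^sub>1 = A\<^sup>l v\<close> for \<open>l < n\<close> (\<open>column_moments\<close>). Writing \<open>j \<le> 2n - 1\<close> as \<open>i + s + l\<close> with
  \<open>i, l < n\<close> and \<open>s \<le> 1\<close>, one gets
  \<open>w\<^sup>H A\<^sup>j v = e\<^sub>1\<^sup>H T\<^sup>i (W A\<^sup>s V) T\<^sup>l e\<^sub>1 = e\<^sub>1\<^sup>H T\<^sup>i T\<^sup>s T\<^sup>l e\<^sub>1\<close> (\<open>moment_matching\<close>).
\<close>

section \<open>Differentiation on an interval\<close>

text \<open>
  The chain rule along \<open>t \<mapsto> (t, t)\<close>. Only the second partial derivative has to be continuous, and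
  the two arguments may range over different sets: the second one will be the upper limit of an
  integral, which is differentiated on a compact subinterval only.
\<close>

lemma has_vector_derivative_diagonal:
  fixes g :: "real \<Rightarrow> real \<Rightarrow> complex"
  assumes gx: "((\<lambda>x. g x s) has_vector_derivative gx) (at s within X)"
    and gy: "\<And>x y. x \<in> X \<Longrightarrow> y \<in> Y \<Longrightarrow> ((\<lambda>y. g x y) has_vector_derivative gy x y) (at y within Y)"
    and cont: "continuous_on (X \<times> Y) (\<lambda>(x, y). gy x y)"
    and s: "s \<in> X" "s \<in> Y" "convex Y"
  shows "((\<lambda>t. g t t) has_vector_derivative gx + gy s s) (at s within X \<inter> Y)"
proof -
  have cont': "continuous (at (s, s) within X \<times> Y) (\<lambda>(x, y). blinfun_scaleR_left (gy x y))"
  proof -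
    have "continuous (at (s, s) within X \<times> Y) (\<lambda>p. (case p of (x, y) \<Rightarrow> gy x y))"
      using cont s by (simp add: continuous_on_eq_continuous_within)
    from bounded_linear.continuous[OF bounded_linear_blinfun_scaleR_left this]
    show ?thesis by (simp add: case_prod_beta')
  qed
  have D: "((\<lambda>(x, y). g x y) has_derivative
      (\<lambda>(tx, ty). tx *\<^sub>R gx + blinfun_apply (blinfun_scaleR_left (gy s s)) ty)) (at (s, s) within X \<times> Y)"
    by (rule has_derivative_partialsI[where fy = "\<lambda>x y. blinfun_scaleR_left (gy x y)"])
       (use gx gy cont' s in \<open>simp_all add: has_vector_derivative_def\<close>)
  have P: "((\<lambda>t. (t, t)) has_derivative (\<lambda>h. (h, h))) (at s within X \<inter> Y)"
    by (auto intro!: derivative_eq_intros)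
  have "((\<lambda>(x, y). g x y) has_derivative
      (\<lambda>(tx, ty). tx *\<^sub>R gx + blinfun_apply (blinfun_scaleR_left (gy s s)) ty))
      (at (s, s) within (\<lambda>t. (t, t)) ` (X \<inter> Y))"
    by (rule has_derivative_subset[OF D]) auto
  from has_derivative_in_compose[OF P this]
  show ?thesis
    by (simp add: has_vector_derivative_def o_def scaleR_add_right)
qed

locale real_interval =
  fixes I :: "real set"
  assumes interval: "is_interval I" and interior: "interior I \<noteq> {}"
begin

lemma convex_I: "convex I"
  using interval by (simp add: is_interval_convex)

lemma subset_I: "a \<in> I \<Longrightarrow> b \<in> I \<Longrightarrow> {a..b} \<subseteq> I"
  using interval unfolding is_interval_1 by (meson atLeastAtMost_iff subsetI)

text \<open>
  Derivatives within \<open>I\<close> are unique because no point of \<open>I\<close> is isolated.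
\<close>

lemma no_isolated_point:
  assumes "t \<in> I" shows "t islimpt I"
proof -
  obtain c where c: "c \<in> interior I" using interior by auto
  then obtain e where e: "e > 0" "ball c e \<subseteq> I"
    by (auto simp: mem_interior)
  have "c \<in> ball c e" "c + e / 2 \<in> ball c e"
    using e(1) by (simp_all add: dist_real_def)
  with e have "c \<in> I" "c + e / 2 \<in> I" by blast+
  then have "I \<noteq> {x}" for x using e(1) by (cases "x = c") auto
  then show ?thesis
    using connected_imp_perfect[of I t] convex_connected[OF convex_I] assms by blast
qed

lemma at_within_nontrivial: "t \<in> I \<Longrightarrow> at t within I \<noteq> bot"
  using no_isolated_point by (simp add: trivial_limit_within)

lemma deriv_on_eq:
  "(f has_vector_derivative d) (at t within I) \<Longrightarrow> t \<in> I \<Longrightarrow> deriv_on I f t = d"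
  unfolding deriv_on_def by (rule vector_derivative_within[OF at_within_nontrivial])

lemma deriv_on_works:
  "f differentiable (at t within I) \<Longrightarrow> (f has_vector_derivative deriv_on I f t) (at t within I)"
  by (simp add: deriv_on_def vector_derivative_works)

lemma has_vector_derivative_cong_I:
  assumes "\<And>x. x \<in> I \<Longrightarrow> f x = g x" "t \<in> I"
  shows "(f has_vector_derivative d) (at t within I) \<longleftrightarrow> (g has_vector_derivative d) (at t within I)"
  using assms by (intro has_vector_derivative_cong_ev) (auto simp: eventually_at_filter)

lemma deriv_on_cong:
  assumes "\<And>x. x \<in> I \<Longrightarrow> f x = g x" "t \<in> I"
  shows "deriv_on I f t = deriv_on I g t"
  unfolding deriv_on_def vector_derivative_def
  using has_vector_derivative_cong_I[OF assms] by simp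

lemma differentiable_cong_I:
  fixes f g :: "real \<Rightarrow> complex"
  assumes "\<And>x. x \<in> I \<Longrightarrow> f x = g x" "t \<in> I"
  shows "f differentiable (at t within I) \<longleftrightarrow> g differentiable (at t within I)"
  using has_vector_derivative_cong_I[OF assms]
  by (simp add: vector_derivative_works deriv_on_cong[OF assms, unfolded deriv_on_def])

lemma funpow_deriv_on_cong:
  "(\<And>x. x \<in> I \<Longrightarrow> f x = g x) \<Longrightarrow> t \<in> I \<Longrightarrow> (deriv_on I ^^ k) f t = (deriv_on I ^^ k) g t"
  by (induction k arbitrary: t) (auto intro: deriv_on_cong)

text \<open>
  Smoothness is treated as \<open>k\<close>-fold differentiability for every \<open>k\<close>, with the derivative existentially
  quantified. This makes closure properties inductions on \<open>k\<close> in which an explicit formula for the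
  derivative, valid on \<open>I\<close> only, can be supplied.
\<close>

primrec times_differentiable :: "nat \<Rightarrow> (real \<Rightarrow> complex) \<Rightarrow> bool" where
  "times_differentiable 0 f \<longleftrightarrow> True"
| "times_differentiable (Suc k) f \<longleftrightarrow>
     (\<exists>f'. (\<forall>t\<in>I. (f has_vector_derivative f' t) (at t within I)) \<and> times_differentiable k f')"

lemma times_differentiable_cong:
  assumes "\<And>x. x \<in> I \<Longrightarrow> f x = g x"
  shows "times_differentiable k f \<longleftrightarrow> times_differentiable k g"
  using has_vector_derivative_cong_I[OF assms] by (cases k) simp_all

lemma times_differentiable_Suc_iff:
  "times_differentiable (Suc k) f \<longleftrightarrow>
     (\<forall>t\<in>I. f differentiable (at t within I)) \<and> times_differentiable k (deriv_on I f)"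
proof
  assume "times_differentiable (Suc k) f"
  then obtain f' where f': "\<forall>t\<in>I. (f has_vector_derivative f' t) (at t within I)" "times_differentiable k f'"
    by auto
  then have "times_differentiable k (deriv_on I f)"
    using times_differentiable_cong[of f' "deriv_on I f" k] deriv_on_eq by metis
  with f' show "(\<forall>t\<in>I. f differentiable (at t within I)) \<and> times_differentiable k (deriv_on I f)"
    using differentiableI_vector by blast
qed (auto intro: deriv_on_works)

lemma smooth_on_deriv_on: "smooth_on I f \<Longrightarrow> smooth_on I (deriv_on I f)"
  unfolding smooth_on_def
proof (intro allI)
  fix k assume "\<forall>k. \<forall>t\<in>I. (deriv_on I ^^ k) f differentiable at t within I"
  then have "\<forall>t\<in>I. (deriv_on I ^^ Suc k) f differentiable at t within I" by blast
  then show "\<forall>t\<in>I. (deriv_on I ^^ k) (deriv_on I f) differentiable at t within I"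
    by (simp only: funpow_Suc_right o_apply)
qed

lemma smooth_on_has_deriv:
  assumes "smooth_on I f" "t \<in> I"
  shows "(f has_vector_derivative deriv_on I f t) (at t within I)"
  using assms(1)[unfolded smooth_on_def, rule_format, OF assms(2), of 0] by (auto intro: deriv_on_works)

lemma smooth_on_iff: "smooth_on I f \<longleftrightarrow> (\<forall>k. times_differentiable k f)"
proof
  have "times_differentiable k f" if "smooth_on I f" for k f
    using that
  proof (induction k arbitrary: f)
    case (Suc k)
    have "smooth_on I (deriv_on I f)"
      by (rule smooth_on_deriv_on) fact
    moreover have "\<forall>t\<in>I. f differentiable (at t within I)"
      using Suc.prems smooth_on_has_deriv differentiableI_vector by blast
    ultimately show ?case
      using Suc.IH unfolding times_differentiable_Suc_iff by blast
  qed simp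
  then show "smooth_on I f \<Longrightarrow> \<forall>k. times_differentiable k f" by blast
next
  have "\<forall>t\<in>I. (deriv_on I ^^ k) f differentiable (at t within I)"
    if "times_differentiable (Suc k) f" for k f
    using that
  proof (induction k arbitrary: f)
    case 0
    then show ?case by (auto intro: differentiableI_vector)
  next
    case (Suc k)
    from Suc.prems have "times_differentiable (Suc k) (deriv_on I f)"
      by (simp only: times_differentiable_Suc_iff[of "Suc k" f])
    from Suc.IH[OF this] show ?case by (simp only: funpow_Suc_right o_apply)
  qed
  then show "\<forall>k. times_differentiable k f \<Longrightarrow> smooth_on I f"
    unfolding smooth_on_def by blast
qed

lemma times_differentiable_decrease: "times_differentiable (Suc k) f \<Longrightarrow> times_differentiable k f"
proof (induction k arbitrary: f)
  case (Suc k)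
  then show ?case by (subst (asm) times_differentiable.simps(2)) (auto simp del: times_differentiable.simps(2), auto)
qed simp

lemma times_differentiable_add:
  "times_differentiable k f \<Longrightarrow> times_differentiable k g \<Longrightarrow> times_differentiable k (\<lambda>t. f t + g t)"
proof (induction k arbitrary: f g)
  case (Suc k)
  then obtain f' g' where "\<forall>t\<in>I. (f has_vector_derivative f' t) (at t within I)" "times_differentiable k f'"
    "\<forall>t\<in>I. (g has_vector_derivative g' t) (at t within I)" "times_differentiable k g'"
    by auto
  with Suc.IH[of f' g'] show ?case
    by (auto intro!: exI[of _ "\<lambda>t. f' t + g' t"] derivative_intros)
qed simp

lemma times_differentiable_mult:
  "times_differentiable k f \<Longrightarrow> times_differentiable k g \<Longrightarrow> times_differentiable k (\<lambda>t. f t * g t)"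
proof (induction k arbitrary: f g)
  case (Suc k)
  then obtain f' g' where *: "\<forall>t\<in>I. (f has_vector_derivative f' t) (at t within I)" "times_differentiable k f'"
    "\<forall>t\<in>I. (g has_vector_derivative g' t) (at t within I)" "times_differentiable k g'"
    by auto
  have "times_differentiable k f" "times_differentiable k g"
    using Suc.prems times_differentiable_decrease by blast+
  with * Suc.IH have "times_differentiable k (\<lambda>t. f t * g' t + f' t * g t)"
    by (intro times_differentiable_add) auto
  with * show ?case
    by (auto intro!: exI[of _ "\<lambda>t. f t * g' t + f' t * g t"] has_vector_derivative_mult)
qed simp

lemma times_differentiable_const: "times_differentiable k (\<lambda>_. c)"
  by (induction k arbitrary: c) (auto intro!: exI[of _ "\<lambda>_. 0"] derivative_intros)

lemma smooth_on_add: "smooth_on I f \<Longrightarrow> smooth_on I g \<Longrightarrow> smooth_on I (\<lambda>t. f t + g t)"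
  by (simp add: smooth_on_iff times_differentiable_add)

lemma smooth_on_mult: "smooth_on I f \<Longrightarrow> smooth_on I g \<Longrightarrow> smooth_on I (\<lambda>t. f t * g t)"
  by (simp add: smooth_on_iff times_differentiable_mult)

lemma smooth_on_const: "smooth_on I (\<lambda>_. c)"
  by (simp add: smooth_on_iff times_differentiable_const)

lemma smooth_on_continuous: "smooth_on I f \<Longrightarrow> continuous_on I f"
  using smooth_on_has_deriv has_vector_derivative_continuous
  by (metis continuous_on_eq_continuous_within)

text \<open>
  Continuous functions are integrated over compact intervals, whereas \<open>I\<close> need not be compact.
  Every point of \<open>I\<close> has a compact interval \<open>{a..b} \<subseteq> I\<close> as a neighbourhood relative to \<open>I\<close>, and
  \<open>a\<close> can be chosen below a prescribed point \<open>c\<close>; later, a test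
  function vanishes up to \<open>c\<close>, hence up to \<open>a\<close>.
\<close>

lemma compact_neighbourhood:
  assumes "y \<in> I" "c \<in> I"
  obtains a b e where "a \<in> I" "b \<in> I" "a \<le> c" "a \<le> y" "y \<le> b" "a < b" "e > 0"
    "\<And>z. z \<in> I \<Longrightarrow> \<bar>z - y\<bar> < e \<Longrightarrow> z \<in> {a..b}"
proof -
  have l: "\<exists>a e. a \<in> I \<and> a \<le> y \<and> a \<le> c \<and> e > 0 \<and> (\<forall>z\<in>I. \<bar>z - y\<bar> < e \<longrightarrow> a \<le> z)"
  proof (cases "\<exists>a\<in>I. a < y")
    case True
    then obtain a where "a \<in> I" "a < y" by auto
    then show ?thesis using assms
      by (intro exI[of _ "min a c"] exI[of _ "y - a"]) (auto simp: min_def)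
  next
    case False
    then show ?thesis using assms
      by (intro exI[of _ "min y c"] exI[of _ 1]) (auto simp: min_def not_less)
  qed
  have r: "\<exists>b e. b \<in> I \<and> y \<le> b \<and> e > 0 \<and> (\<forall>z\<in>I. \<bar>z - y\<bar> < e \<longrightarrow> z \<le> b)"
  proof (cases "\<exists>b\<in>I. b > y")
    case True
    then obtain b where "b \<in> I" "b > y" by auto
    then show ?thesis by (intro exI[of _ b] exI[of _ "b - y"]) auto
  next
    case False
    then show ?thesis using assms by (intro exI[of _ y] exI[of _ 1]) (auto simp: not_less)
  qed
  obtain a e1 b e2 where *: "a \<in> I" "a \<le> y" "a \<le> c" "e1 > 0" "\<And>z. z\<in>I \<Longrightarrow> \<bar>z - y\<bar> < e1 \<Longrightarrow> a \<le> z"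
    "b \<in> I" "y \<le> b" "e2 > 0" "\<And>z. z\<in>I \<Longrightarrow> \<bar>z - y\<bar> < e2 \<Longrightarrow> z \<le> b"
    using l r by blast
  have "a \<noteq> b"
  proof
    assume "a = b"
    obtain z where "z \<in> I" "z \<noteq> y" "dist z y < min e1 e2"
      using no_isolated_point[OF assms(1)] * by (auto simp: islimpt_approachable dest: spec[of _ "min e1 e2"])
    with *(5,9)[of z] *(2,7) \<open>a = b\<close> show False by (auto simp: dist_real_def)
  qed
  with * show ?thesis
    by (intro that[of a b "min e1 e2"]) auto
qed

lemma has_vector_derivative_local:
  assumes "(f has_vector_derivative d) (at y within I \<inter> {a..b})" "e > 0"
    "\<And>z. z \<in> I \<Longrightarrow> \<bar>z - y\<bar> < e \<Longrightarrow> z \<in> {a..b}"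
  shows "(f has_vector_derivative d) (at y within I)"
proof -
  have "at y within I = at y within (I \<inter> {a..b})"
    by (rule at_within_nhd[of y "ball y e"])
      (use assms in \<open>auto simp: dist_real_def abs_minus_commute\<close>)
  with assms(1) show ?thesis by simp
qed

section \<open>Smooth functions of two variables\<close>

lemma pd_cong:
  assumes "\<And>x y. x \<in> I \<Longrightarrow> y \<in> I \<Longrightarrow> f x y = g x y" "x \<in> I" "y \<in> I"
  shows "pd1 I f x y = pd1 I g x y" "pd2 I f x y = pd2 I g x y"
  unfolding pd1_def pd2_def using assms by (auto intro!: deriv_on_cong)

lemma funpow_pd1_cong:
  assumes "\<And>x y. x \<in> I \<Longrightarrow> y \<in> I \<Longrightarrow> f x y = g x y" "x \<in> I" "y \<in> I"
  shows "(pd1 I ^^ i) f x y = (pd1 I ^^ i) g x y"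
  using assms(2,3) by (induction i arbitrary: x y) (auto intro: pd_cong assms)

lemma smooth2_on_pd2:
  assumes "smooth2_on I f" shows "smooth2_on I (pd2 I f)"
  unfolding smooth2_on_def
proof (intro allI)
  fix i j
  show "let g = (pd1 I ^^ i) ((pd2 I ^^ j) (pd2 I f)) in
        continuous_on (I \<times> I) (\<lambda>(t', t). g t' t) \<and>
        (\<forall>t'\<in>I. \<forall>t\<in>I. (\<lambda>x. g x t) differentiable (at t' within I) \<and>
                        (\<lambda>x. g t' x) differentiable (at t within I))"
    using assms[unfolded smooth2_on_def, rule_format, of i "Suc j"]
    by (simp only: funpow_Suc_right o_apply)
qed

lemma
  assumes "smooth2_on I f"
  shows smooth2_on_continuous: "continuous_on (I \<times> I) (\<lambda>(x, y). f x y)"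
    and smooth2_on_pd1_continuous: "continuous_on (I \<times> I) (\<lambda>(x, y). pd1 I f x y)"
    and smooth2_on_has_pd1:
      "x \<in> I \<Longrightarrow> y \<in> I \<Longrightarrow> ((\<lambda>x. f x y) has_vector_derivative pd1 I f x y) (at x within I)"
    and smooth2_on_has_pd2:
      "x \<in> I \<Longrightarrow> y \<in> I \<Longrightarrow> ((\<lambda>y. f x y) has_vector_derivative pd2 I f x y) (at y within I)"
    and smooth2_on_pd1_differentiable2:
      "x \<in> I \<Longrightarrow> y \<in> I \<Longrightarrow> ((\<lambda>y. pd1 I f x y) has_vector_derivative pd2 I (pd1 I f) x y) (at y within I)"
proof -
  note S0 = assms[unfolded smooth2_on_def Let_def, rule_format, of 0 0, unfolded funpow_0]
  note S1 = assms[unfolded smooth2_on_def Let_def, rule_format, of 1 0,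
      unfolded funpow_0 One_nat_def funpow.simps o_apply id_apply]
  show "continuous_on (I \<times> I) (\<lambda>(x, y). f x y)" "continuous_on (I \<times> I) (\<lambda>(x, y). pd1 I f x y)"
    using S0 S1 by blast+
  assume xy: "x \<in> I" "y \<in> I"
  show "((\<lambda>x. f x y) has_vector_derivative pd1 I f x y) (at x within I)"
    "((\<lambda>y. f x y) has_vector_derivative pd2 I f x y) (at y within I)"
    "((\<lambda>y. pd1 I f x y) has_vector_derivative pd2 I (pd1 I f) x y) (at y within I)"
    unfolding pd1_def[of I f x y] pd2_def using S0 S1 xy by (blast intro: deriv_on_works)+
qed

lemma continuous_on_slice:
  fixes g :: "real \<Rightarrow> real \<Rightarrow> complex"
  assumes "continuous_on (I \<times> I) (\<lambda>(x, y). g x y)" "x \<in> I" "S \<subseteq> I"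
  shows "continuous_on S (g x)"
proof -
  have "continuous_on S (\<lambda>s. (x, s))"
    by (rule continuous_on_Pair[OF continuous_on_const continuous_on_id])
  from continuous_on_compose2[OF assms(1) this] assms(2,3) show ?thesis by auto
qed

text \<open>
  Differentiating \<open>f(x,t) = f(x,a) + \<integral>\<^sub>a\<^sup>t \<partial>\<^sub>2f(x,u) du\<close> under the integral sign gives
  \<open>\<partial>\<^sub>1f(x,t) = \<partial>\<^sub>1f(x,a) + \<integral>\<^sub>a\<^sup>t \<partial>\<^sub>1\<partial>\<^sub>2f(x,u) du\<close>, and the claim follows by differentiating in \<open>t\<close>.
  Both steps use that \<open>\<partial>\<^sub>1\<partial>\<^sub>2f\<close> is continuous.
\<close>

lemma partials_commute:
  assumes f: "smooth2_on I f" and x: "x \<in> I" and y: "y \<in> I"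
  shows "pd2 I (pd1 I f) x y = pd1 I (pd2 I f) x y"
proof -
  obtain a b e where ab: "a \<in> I" "b \<in> I" "a \<le> y" "y \<le> b" "a < b"
    "e > 0" "\<And>z. z \<in> I \<Longrightarrow> \<bar>z - y\<bar> < e \<Longrightarrow> z \<in> {a..b}"
    using compact_neighbourhood[OF y y] by metis
  note sub = subset_I[OF ab(1,2)]
  note f2 = smooth2_on_pd2[OF f]
  note cont = continuous_on_slice[OF _ _ sub]
  have eq: "pd1 I f x t = pd1 I f x a + integral {a..t} (pd1 I (pd2 I f) x)" if t: "t \<in> {a..b}" for t
  proof -
    have tI: "t \<in> I" "{a..t} \<subseteq> I" using t sub by auto
    have fz: "f z t = f z a + integral {a..t} (pd2 I f z)" if "z \<in> I" for z
    proof -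
      have "(pd2 I f z has_integral (f z t - f z a)) {a..t}"
        using t tI(2) that
        by (intro fundamental_theorem_of_calculus
            has_vector_derivative_within_subset[OF smooth2_on_has_pd2[OF f] tI(2)]) auto
      then show ?thesis by (simp add: integral_unique)
    qed
    have "((\<lambda>z. integral (cbox a t) (pd2 I f z)) has_vector_derivative
        integral (cbox a t) (pd1 I (pd2 I f) x)) (at x within I)"
    proof (rule leibniz_rule_vector_derivative[OF _ _ _ x convex_I])
      show "continuous_on (I \<times> cbox a t) (\<lambda>(x, t). pd1 I (pd2 I f) x t)"
        by (rule continuous_on_subset[OF smooth2_on_pd1_continuous[OF f2]]) (use tI in auto)
      show "pd2 I f z integrable_on cbox a t" if "z \<in> I" for z
        using cont[OF smooth2_on_continuous[OF f2] that] t
        by (auto intro!: integrable_continuous_real intro: continuous_on_subset)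
    qed (use tI smooth2_on_has_pd1[OF f2] in auto)
    from has_vector_derivative_add[OF smooth2_on_has_pd1[OF f x \<open>a \<in> I\<close>] this]
    have "((\<lambda>z. f z t) has_vector_derivative
        pd1 I f x a + integral {a..t} (pd1 I (pd2 I f) x)) (at x within I)"
      using fz by (subst has_vector_derivative_cong_I[OF _ x]) auto
    then show ?thesis unfolding pd1_def[of I f x t] using deriv_on_eq x by blast
  qed
  have "((\<lambda>t. pd1 I f x a + integral {a..t} (pd1 I (pd2 I f) x)) has_vector_derivative
      pd1 I (pd2 I f) x y) (at y within {a..b})"
    using integral_has_vector_derivative[OF cont[OF smooth2_on_pd1_continuous[OF f2] x], of y] ab
    by (auto intro!: derivative_eq_intros)
  then have "((\<lambda>t. pd1 I f x t) has_vector_derivative pd1 I (pd2 I f) x y) (at y within {a..b})"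
    by (rule has_vector_derivative_transform[rotated 2]) (use ab in \<open>simp, simp only: eq\<close>)
  moreover have "((\<lambda>t. pd1 I f x t) has_vector_derivative pd2 I (pd1 I f) x y) (at y within {a..b})"
    using smooth2_on_pd1_differentiable2[OF f x y] sub by (rule has_vector_derivative_within_subset)
  ultimately show ?thesis
    using ab by (intro vector_derivative_unique_within_closed_interval[of a b y "pd1 I f x"]) auto
qed

text \<open>
  Smoothness is defined by the derivatives \<open>\<partial>\<^sub>1\<^sup>i \<partial>\<^sub>2\<^sup>j f\<close> in this order, so the order has to be changed
  before it can be inherited by \<open>\<partial>\<^sub>1f\<close>.
\<close>

lemma smooth2_on_pd1:
  assumes "smooth2_on I f" shows "smooth2_on I (pd1 I f)"
proof -
  have comm: "(pd2 I ^^ j) (pd1 I f) x y = pd1 I ((pd2 I ^^ j) f) x y"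
    if "smooth2_on I f" "x \<in> I" "y \<in> I" for f j x y
    using that
  proof (induction j arbitrary: f x y)
    case (Suc j)
    have sm: "smooth2_on I ((pd2 I ^^ j) f)"
      using Suc.prems(1) by (induction j) (auto intro: smooth2_on_pd2)
    have "(pd2 I ^^ Suc j) (pd1 I f) x y = pd2 I (pd1 I ((pd2 I ^^ j) f)) x y"
      using Suc by (auto intro: pd_cong)
    also have "\<dots> = pd1 I (pd2 I ((pd2 I ^^ j) f)) x y"
      by (rule partials_commute[OF sm Suc.prems(2,3)])
    finally show ?case by simp
  qed simp
  have eq: "(pd1 I ^^ i) ((pd2 I ^^ j) (pd1 I f)) x y = (pd1 I ^^ Suc i) ((pd2 I ^^ j) f) x y"
    if "x \<in> I" "y \<in> I" for i j x y
    unfolding funpow_Suc_right o_apply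
    by (rule funpow_pd1_cong[OF comm[OF assms]]) (use that in auto)
  show ?thesis
    unfolding smooth2_on_def Let_def
  proof (intro allI conjI ballI)
    fix i j
    note S = assms[unfolded smooth2_on_def Let_def, rule_format, of "Suc i" j]
    show "continuous_on (I \<times> I) (\<lambda>(t', t). (pd1 I ^^ i) ((pd2 I ^^ j) (pd1 I f)) t' t)"
      using conjunct1[OF S] by (rule continuous_on_eq) (auto simp: eq simp del: funpow.simps)
    fix x y assume xy: "x \<in> I" "y \<in> I"
    show "(\<lambda>x. (pd1 I ^^ i) ((pd2 I ^^ j) (pd1 I f)) x y) differentiable at x within I"
      using S xy by (subst differentiable_cong_I[OF eq]) auto
    show "(\<lambda>y. (pd1 I ^^ i) ((pd2 I ^^ j) (pd1 I f)) x y) differentiable at y within I"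
      using S xy by (subst differentiable_cong_I[OF eq]) auto
  qed
qed

text \<open>
  The derivative of \<open>f(t,t)\<close> is \<open>(\<partial>\<^sub>1f + \<partial>\<^sub>2f)(t,t)\<close>, and both terms are again diagonals of smooth functions.
\<close>

lemma smooth_on_diagonal:
  assumes "smooth2_on I f" shows "smooth_on I (\<lambda>t. f t t)"
proof -
  have "times_differentiable k (\<lambda>t. f t t)" if "smooth2_on I f" for k f
    using that
  proof (induction k arbitrary: f)
    case (Suc k)
    have "((\<lambda>t. f t t) has_vector_derivative pd1 I f s s + pd2 I f s s) (at s within I)" if "s \<in> I" for s
    proof -
      have "((\<lambda>t. f t t) has_vector_derivative pd1 I f s s + pd2 I f s s) (at s within I \<inter> I)"
        by (rule has_vector_derivative_diagonal[OF smooth2_on_has_pd1[OF Suc.prems that that]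
              smooth2_on_has_pd2[OF Suc.prems] smooth2_on_continuous[OF smooth2_on_pd2[OF Suc.prems]]
              that that convex_I])
      then show ?thesis by simp
    qed
    then show ?case
      using Suc.IH[OF smooth2_on_pd1] Suc.IH[OF smooth2_on_pd2] Suc.prems
      by (auto intro!: exI[of _ "\<lambda>t. pd1 I f t t + pd2 I f t t"] times_differentiable_add)
  qed simp
  with assms show ?thesis by (simp add: smooth_on_iff)
qed

section \<open>Distributions preserve test functions\<close>

lemma test_fun_smooth: "test_fun I \<phi> \<Longrightarrow> smooth_on I \<phi>"
  by (simp add: test_fun_def)

lemma test_fun_cong:
  assumes "\<And>t. t \<in> I \<Longrightarrow> \<phi> t = \<psi> t"
  shows "test_fun I \<phi> \<longleftrightarrow> test_fun I \<psi>"
  using assms times_differentiable_cong[OF assms]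
  by (simp add: test_fun_def smooth_on_iff)

lemma test_fun_zero: "test_fun I (\<lambda>_. 0)"
  using interior by (auto simp: test_fun_def smooth_on_const)

lemma test_fun_add:
  assumes "test_fun I \<phi>" "test_fun I \<psi>" shows "test_fun I (\<lambda>t. \<phi> t + \<psi> t)"
proof -
  obtain c d where cd: "c \<in> interior I" "d \<in> interior I" "\<forall>t\<in>I. t \<le> c \<longrightarrow> \<phi> t = 0" "\<forall>t\<in>I. t \<le> d \<longrightarrow> \<psi> t = 0"
    using assms by (auto simp: test_fun_def)
  have "min c d \<in> interior I" using cd by (simp add: min_def)
  with cd show ?thesis
    using assms by (auto simp: test_fun_def smooth_on_add intro!: bexI[of _ "min c d"])
qed

lemma test_fun_mult:
  "smooth_on I f \<Longrightarrow> test_fun I \<phi> \<Longrightarrow> test_fun I (\<lambda>t. f t * \<phi> t)"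
  by (force simp: test_fun_def smooth_on_mult)

lemma test_fun_deriv_on:
  assumes "test_fun I \<phi>" shows "test_fun I (deriv_on I \<phi>)"
proof -
  obtain c where c: "c \<in> interior I" "\<forall>t\<in>I. t \<le> c \<longrightarrow> \<phi> t = 0"
    using assms by (auto simp: test_fun_def)
  then obtain e where e: "e > 0" "ball c e \<subseteq> interior I"
    by (meson open_contains_ball open_interior)
  \<comment> \<open>Near \<open>c\<close> itself \<open>\<phi>\<close> need not vanish on both sides, so the zero set is shrunk.\<close>
  have "c - e / 2 \<in> interior I"
    using e by (auto simp: dist_real_def intro!: subsetD[OF e(2)])
  moreover have "deriv_on I \<phi> t = 0" if t: "t \<in> I" "t \<le> c - e / 2" for t
  proof -
    have "(\<phi> has_vector_derivative 0) (at t within I)"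
      by (rule has_vector_derivative_transform_within[OF has_vector_derivative_const[of 0], of "e / 2"])
        (use c e t in \<open>auto simp: dist_real_def abs_if split: if_splits\<close>)
    then show ?thesis by (rule deriv_on_eq) fact
  qed
  ultimately show ?thesis
    using assms by (auto simp: test_fun_def smooth_on_deriv_on)
qed

lemma funpow_deriv_on_add:
  assumes "smooth_on I f" "smooth_on I g" "t \<in> I"
  shows "(deriv_on I ^^ i) (\<lambda>t. f t + g t) t = (deriv_on I ^^ i) f t + (deriv_on I ^^ i) g t"
  using assms
proof (induction i arbitrary: f g t)
  case (Suc i)
  have "(deriv_on I ^^ Suc i) (\<lambda>t. f t + g t) t = (deriv_on I ^^ i) (\<lambda>t. deriv_on I f t + deriv_on I g t) t"
    unfolding funpow_Suc_right o_apply using Suc.prems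
    by (intro funpow_deriv_on_cong deriv_on_eq has_vector_derivative_add smooth_on_has_deriv)
  then show ?case
    using Suc.IH[OF smooth_on_deriv_on smooth_on_deriv_on] Suc.prems
    by (simp only: funpow_Suc_right o_apply)
qed simp

lemma funpow_deriv_on_cmult:
  assumes "smooth_on I f" "t \<in> I"
  shows "(deriv_on I ^^ i) (\<lambda>t. a * f t) t = a * (deriv_on I ^^ i) f t"
  using assms
proof (induction i arbitrary: f t)
  case (Suc i)
  have "(deriv_on I ^^ Suc i) (\<lambda>t. a * f t) t = (deriv_on I ^^ i) (\<lambda>t. a * deriv_on I f t) t"
    unfolding funpow_Suc_right o_apply using Suc.prems
    by (intro funpow_deriv_on_cong deriv_on_eq has_vector_derivative_mult_right smooth_on_has_deriv)
  then show ?case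
    using Suc.IH[OF smooth_on_deriv_on] Suc.prems
    by (simp only: funpow_Suc_right o_apply)
qed simp

lemma smooth_on_slice:
  assumes "smooth2_on I f" "x \<in> I" shows "smooth_on I (f x)"
proof -
  have "times_differentiable k (f x)" if "smooth2_on I f" for k f
    using that
  proof (induction k arbitrary: f)
    case (Suc k)
    have "times_differentiable k (pd2 I f x)" using Suc smooth2_on_pd2 by blast
    moreover have "\<forall>t\<in>I. (f x has_vector_derivative pd2 I f x t) (at t within I)"
      using smooth2_on_has_pd2[OF Suc.prems assms(2)] by blast
    ultimately show ?case by auto
  qed simp
  with assms show ?thesis by (simp add: smooth_on_iff)
qed

text \<open>
  The action of \<open>f(t',t) \<delta>\<^sup>(\<^sup>i\<^sup>)(t'-t)\<close>. By the product rule, \<open>\<partial>\<^sub>t\<^sup>i\<^sup>+\<^sup>1(f \<phi>) = \<partial>\<^sub>t\<^sup>i(f \<phi>') + \<partial>\<^sub>t\<^sup>i((\<partial>\<^sub>2f) \<phi>)\<close>;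
  each summand is covered by the induction hypothesis, since \<open>\<phi>'\<close> is a test function and \<open>\<partial>\<^sub>2f\<close> is smooth.
\<close>

lemma test_fun_diagonal_deriv:
  assumes "smooth2_on I f" "test_fun I \<phi>"
  shows "test_fun I (\<lambda>x. (deriv_on I ^^ i) (\<lambda>t. f x t * \<phi> t) x)"
  using assms
proof (induction i arbitrary: f \<phi>)
  case 0
  then show ?case by (simp add: test_fun_mult smooth_on_diagonal)
next
  case (Suc i)
  note f = \<open>smooth2_on I f\<close> and \<phi> = \<open>test_fun I \<phi>\<close>
  have "(deriv_on I ^^ Suc i) (\<lambda>t. f x t * \<phi> t) x =
      (deriv_on I ^^ i) (\<lambda>t. f x t * deriv_on I \<phi> t) x + (deriv_on I ^^ i) (\<lambda>t. pd2 I f x t * \<phi> t) x"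
    if "x \<in> I" for x
  proof -
    have "(deriv_on I ^^ Suc i) (\<lambda>t. f x t * \<phi> t) x =
        (deriv_on I ^^ i) (\<lambda>t. f x t * deriv_on I \<phi> t + pd2 I f x t * \<phi> t) x"
      unfolding funpow_Suc_right o_apply using that
      by (intro funpow_deriv_on_cong deriv_on_eq has_vector_derivative_mult smooth_on_has_deriv
          smooth2_on_has_pd2 f test_fun_smooth \<phi>)
    also have "\<dots> = (deriv_on I ^^ i) (\<lambda>t. f x t * deriv_on I \<phi> t) x + (deriv_on I ^^ i) (\<lambda>t. pd2 I f x t * \<phi> t) x"
      using that by (intro funpow_deriv_on_add smooth_on_mult smooth_on_slice smooth_on_deriv_on
          smooth2_on_pd2 f test_fun_smooth \<phi>)
    finally show ?thesis .
  qed
  then have "test_fun I (\<lambda>x. (deriv_on I ^^ Suc i) (\<lambda>t. f x t * \<phi> t) x) \<longleftrightarrow>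
     test_fun I (\<lambda>x. (deriv_on I ^^ i) (\<lambda>t. f x t * deriv_on I \<phi> t) x
                   + (deriv_on I ^^ i) (\<lambda>t. pd2 I f x t * \<phi> t) x)"
    by (rule test_fun_cong)
  then show ?case
    using test_fun_add Suc.IH[OF f test_fun_deriv_on[OF \<phi>]] Suc.IH[OF smooth2_on_pd2[OF f] \<phi>] by blast
qed

lemma integral_Heaviside:
  fixes f :: "real \<Rightarrow> real \<Rightarrow> complex"
  assumes "a \<in> I" "x \<in> I" "\<And>t. t \<in> I \<Longrightarrow> t \<le> a \<Longrightarrow> \<phi> t = 0"
  shows "integral I (\<lambda>t. f x t * Heaviside (x - t) * \<phi> t) = integral {a..x} (\<lambda>t. f x t * \<phi> t)"
proof -
  have "integral I (\<lambda>t. f x t * Heaviside (x - t) * \<phi> t) =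
      integral I (\<lambda>t. if t \<in> {a..x} then f x t * \<phi> t else 0)"
    using assms(3) by (intro Henstock_Kurzweil_Integration.integral_cong) (auto simp: Heaviside_def)
  also have "\<dots> = integral {a..x} (\<lambda>t. f x t * \<phi> t)"
    using subset_I[OF assms(1,2)]
    by (simp only: Henstock_Kurzweil_Integration.integral_restrict_Int Int_absorb2)
  finally show ?thesis .
qed

lemma continuous_on_times_fun:
  fixes g :: "real \<Rightarrow> real \<Rightarrow> complex"
  assumes "continuous_on (I \<times> I) (\<lambda>(x, y). g x y)" "continuous_on I \<phi>"
  shows "continuous_on (I \<times> I) (\<lambda>(x, y). g x y * \<phi> y)"
proof -
  have "continuous_on (I \<times> I) (\<lambda>p. \<phi> (snd p))"
    by (rule continuous_on_compose2[OF assms(2)]) (auto intro: continuous_intros)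
  from continuous_on_mult[OF assms(1) this] show ?thesis
    by (simp add: case_prod_beta')
qed

text \<open>
  The Leibniz rule for a parameter integral with variable upper limit. If \<open>\<phi>\<close> vanishes up to
  \<open>a\<close>, the integral is \<open>G(x,x)\<close> for \<open>G(x,y) = \<integral>\<^sub>a\<^sup>y f(x,t) \<phi>(t) dt\<close>. The chain rule along the diagonal
  separates differentiation under the integral sign from the fundamental theorem of calculus.
\<close>

lemma Heaviside_integral_has_vector_derivative:
  assumes f: "smooth2_on I f" and \<phi>: "test_fun I \<phi>" and x: "x \<in> I"
  shows "((\<lambda>x. integral I (\<lambda>t. f x t * Heaviside (x - t) * \<phi> t)) has_vector_derivative
    f x x * \<phi> x + integral I (\<lambda>t. pd1 I f x t * Heaviside (x - t) * \<phi> t)) (at x within I)"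
proof -
  obtain c where c: "c \<in> I" "\<And>t. t \<in> I \<Longrightarrow> t \<le> c \<Longrightarrow> \<phi> t = 0"
    using \<phi> interior_subset by (auto simp: test_fun_def)
  obtain a b e where ab: "a \<in> I" "b \<in> I" "a \<le> c" "a \<le> x" "x \<le> b" "e > 0"
    "\<And>z. z \<in> I \<Longrightarrow> \<bar>z - x\<bar> < e \<Longrightarrow> z \<in> {a..b}"
    using compact_neighbourhood[OF x c(1)] by metis
  have \<phi>a: "\<phi> t = 0" if "t \<in> I" "t \<le> a" for t using c ab(3) that by auto
  note sub = subset_I[OF ab(1,2)]
  have contf: "continuous_on (I \<times> I) (\<lambda>(x, y). f x y * \<phi> y)"
    and contd: "continuous_on (I \<times> I) (\<lambda>(x, y). pd1 I f x y * \<phi> y)"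
    using continuous_on_times_fun smooth2_on_continuous f smooth2_on_pd1[OF f]
      smooth_on_continuous[OF test_fun_smooth[OF \<phi>]] by blast+
  let ?G = "\<lambda>x y. integral {a..y} (\<lambda>t. f x t * \<phi> t)"
  have "((\<lambda>t. ?G t t) has_vector_derivative
      integral {a..x} (\<lambda>t. pd1 I f x t * \<phi> t) + f x x * \<phi> x) (at x within I \<inter> {a..b})"
  proof (rule has_vector_derivative_diagonal[where g = ?G and gy = "\<lambda>x y. f x y * \<phi> y"])
    have "((\<lambda>z. integral (cbox a x) (\<lambda>t. f z t * \<phi> t)) has_vector_derivative
        integral (cbox a x) (\<lambda>t. pd1 I f x t * \<phi> t)) (at x within I)"
    proof (rule leibniz_rule_vector_derivative[OF _ _ _ x convex_I])
      have ax: "cbox a x \<subseteq> I" using subset_I[OF ab(1) x] by simp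
      show "continuous_on (I \<times> cbox a x) (\<lambda>(x, t). pd1 I f x t * \<phi> t)"
        by (rule continuous_on_subset[OF contd]) (use ax in auto)
      show "(\<lambda>t. f z t * \<phi> t) integrable_on cbox a x" if "z \<in> I" for z
        by (rule integrable_continuous[OF continuous_on_slice[OF contf that ax]])
      show "((\<lambda>z. f z t * \<phi> t) has_vector_derivative pd1 I f z t * \<phi> t) (at z within I)"
        if "z \<in> I" "t \<in> cbox a x" for z t
        using that ax by (intro has_vector_derivative_mult_left smooth2_on_has_pd1[OF f]) auto
    qed
    then show "((\<lambda>z. integral {a..x} (\<lambda>t. f z t * \<phi> t)) has_vector_derivative
        integral {a..x} (\<lambda>t. pd1 I f x t * \<phi> t)) (at x within I)"
      by simp
    show "(?G z has_vector_derivative f z y * \<phi> y) (at y within {a..b})" if "z \<in> I" "y \<in> {a..b}" for z y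
      by (rule integral_has_vector_derivative[OF continuous_on_slice[OF contf that(1) sub] that(2)])
    show "continuous_on (I \<times> {a..b}) (\<lambda>(x, y). f x y * \<phi> y)"
      by (rule continuous_on_subset[OF contf]) (use sub in auto)
  qed (use x ab in auto)
  from has_vector_derivative_local[OF this ab(6,7)]
  have "((\<lambda>t. ?G t t) has_vector_derivative
      integral {a..x} (\<lambda>t. pd1 I f x t * \<phi> t) + f x x * \<phi> x) (at x within I)" .
  then show ?thesis
    using integral_Heaviside[of a _ \<phi>, OF ab(1) _ \<phi>a] x
    by (subst has_vector_derivative_cong_I[of _ "\<lambda>t. ?G t t"]) (auto simp: add.commute)
qed

text \<open>
  The action of \<open>f(t',t) \<Theta>(t'-t)\<close>. The derivative of the integral is the sum of a diagonal term and the
  same integral for \<open>\<partial>\<^sub>1f\<close>, so smoothness follows by induction on the order. Below a point where \<open>\<phi>\<close> starts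
  to be nonzero the integrand vanishes, since only the values of \<open>\<phi>\<close> at \<open>t \<le> t'\<close> enter.
\<close>

lemma test_fun_Heaviside_integral:
  assumes f: "smooth2_on I f" and \<phi>: "test_fun I \<phi>"
  shows "test_fun I (\<lambda>x. integral I (\<lambda>t. f x t * Heaviside (x - t) * \<phi> t))"
proof -
  have "times_differentiable k (\<lambda>x. integral I (\<lambda>t. f x t * Heaviside (x - t) * \<phi> t))"
    if "smooth2_on I f" for k f
    using that
  proof (induction k arbitrary: f)
    case (Suc k)
    have "times_differentiable k (\<lambda>x. f x x * \<phi> x)"
      using smooth_on_mult[OF smooth_on_diagonal[OF Suc.prems] test_fun_smooth[OF \<phi>]]
      by (simp add: smooth_on_iff)
    from times_differentiable_add[OF this Suc.IH[OF smooth2_on_pd1[OF Suc.prems]]]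
    show ?case
      unfolding times_differentiable.simps(2)
      using Heaviside_integral_has_vector_derivative[OF Suc.prems \<phi>]
      by (intro exI[of _ "\<lambda>x. f x x * \<phi> x + integral I (\<lambda>t. pd1 I f x t * Heaviside (x - t) * \<phi> t)"]) blast
  qed simp
  moreover obtain c where c: "c \<in> interior I" "\<And>t. t \<in> I \<Longrightarrow> t \<le> c \<Longrightarrow> \<phi> t = 0"
    using \<phi> by (auto simp: test_fun_def)
  moreover have "integral I (\<lambda>t. f x t * Heaviside (x - t) * \<phi> t) = 0" if "x \<in> I" "x \<le> c" for x
  proof -
    have "integral I (\<lambda>t. f x t * Heaviside (x - t) * \<phi> t) = integral I (\<lambda>t. 0)"
      using c(2) that by (intro Henstock_Kurzweil_Integration.integral_cong) (auto simp: Heaviside_def)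
    then show ?thesis by simp
  qed
  ultimately show ?thesis
    using f unfolding test_fun_def smooth_on_iff by blast
qed

text \<open>
  The linear operators on the space of test functions, normalised such that equality of operators is
  equality of functions: the value is \<open>0\<close> off \<open>I\<close> and on functions that are not test functions, and it
  depends on the argument only through its values on \<open>I\<close>.
\<close>

definition test_operator :: "distr \<Rightarrow> bool" where
  "test_operator d \<longleftrightarrow>
     (\<forall>t' \<phi>. t' \<notin> I \<or> \<not> test_fun I \<phi> \<longrightarrow> d t' \<phi> = 0) \<and>
     (\<forall>t' \<phi> \<psi>. (\<forall>t\<in>I. \<phi> t = \<psi> t) \<longrightarrow> d t' \<phi> = d t' \<psi>) \<and>
     (\<forall>\<phi>. test_fun I \<phi> \<longrightarrow> test_fun I (\<lambda>t'. d t' \<phi>)) \<and>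
     (\<forall>t' a \<phi> \<psi>. test_fun I \<phi> \<longrightarrow> test_fun I \<psi> \<longrightarrow>
        d t' (\<lambda>t. a * \<phi> t + \<psi> t) = a * d t' \<phi> + d t' \<psi>)"

lemma test_operatorD:
  assumes "test_operator d"
  shows "t' \<notin> I \<Longrightarrow> d t' \<phi> = 0" "\<not> test_fun I \<phi> \<Longrightarrow> d t' \<phi> = 0"
    "(\<And>t. t \<in> I \<Longrightarrow> \<phi> t = \<psi> t) \<Longrightarrow> d t' \<phi> = d t' \<psi>"
    "test_fun I \<phi> \<Longrightarrow> test_fun I (\<lambda>t'. d t' \<phi>)"
    "test_fun I \<phi> \<Longrightarrow> test_fun I \<psi> \<Longrightarrow> d t' (\<lambda>t. a * \<phi> t + \<psi> t) = a * d t' \<phi> + d t' \<psi>"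
  using assms unfolding test_operator_def by blast+

lemma test_fun_cmult: "test_fun I \<phi> \<Longrightarrow> test_fun I (\<lambda>t. a * \<phi> t)"
  using test_fun_mult[OF smooth_on_const] .

lemma test_operator_distr_on:
  assumes cong: "\<And>t' \<phi> \<psi>. t' \<in> I \<Longrightarrow> (\<And>t. t \<in> I \<Longrightarrow> \<phi> t = \<psi> t) \<Longrightarrow> d t' \<phi> = d t' \<psi>"
    and test: "\<And>\<phi>. test_fun I \<phi> \<Longrightarrow> test_fun I (\<lambda>t'. d t' \<phi>)"
    and lin: "\<And>t' a \<phi> \<psi>. t' \<in> I \<Longrightarrow> test_fun I \<phi> \<Longrightarrow> test_fun I \<psi> \<Longrightarrow>
        d t' (\<lambda>t. a * \<phi> t + \<psi> t) = a * d t' \<phi> + d t' \<psi>"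
  shows "test_operator (distr_on I d)"
  unfolding test_operator_def
proof (intro conjI allI impI)
  fix t' \<phi> \<psi> assume eq: "\<forall>t\<in>I. \<phi> t = (\<psi> t :: complex)"
  then have "test_fun I \<phi> \<longleftrightarrow> test_fun I \<psi>" by (intro test_fun_cong) auto
  with eq cong[of t' \<phi> \<psi>] show "distr_on I d t' \<phi> = distr_on I d t' \<psi>"
    by (simp add: distr_on_def)
next
  fix \<phi> assume \<phi>: "test_fun I \<phi>"
  then have "test_fun I (\<lambda>t'. distr_on I d t' \<phi>) \<longleftrightarrow> test_fun I (\<lambda>t'. d t' \<phi>)"
    by (intro test_fun_cong) (simp add: distr_on_def)
  with test[OF \<phi>] show "test_fun I (\<lambda>t'. distr_on I d t' \<phi>)" by simp
next
  fix t' a \<phi> \<psi> assume "test_fun I \<phi>" "test_fun I \<psi>"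
  then show "distr_on I d t' (\<lambda>t. a * \<phi> t + \<psi> t) = a * distr_on I d t' \<phi> + distr_on I d t' \<psi>"
    by (simp add: distr_on_def lin test_fun_add test_fun_cmult)
qed (auto simp: distr_on_def)

lemma test_operator_theta_distr:
  assumes f: "smooth2_on I f" shows "test_operator (theta_distr I f)"
  unfolding theta_distr_def
proof (rule test_operator_distr_on)
  fix t' a \<phi> \<psi> assume t': "t' \<in> I" and \<phi>: "test_fun I \<phi>" and \<psi>: "test_fun I \<psi>"
  obtain c d where cd: "c \<in> I" "d \<in> I"
    "\<And>t. t \<in> I \<Longrightarrow> t \<le> c \<Longrightarrow> \<phi> t = 0" "\<And>t. t \<in> I \<Longrightarrow> t \<le> d \<Longrightarrow> \<psi> t = 0"
    using \<phi> \<psi> interior_subset by (auto simp: test_fun_def) blast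
  define e where "e = min c d"
  have e: "e \<in> I" using cd by (auto simp: e_def min_def)
  have int: "(\<lambda>t. f t' t * \<rho> t) integrable_on {e..t'}" if "test_fun I \<rho>" for \<rho>
    using continuous_on_slice[OF continuous_on_times_fun[OF smooth2_on_continuous[OF f]
          smooth_on_continuous[OF test_fun_smooth[OF that]]] t' subset_I[OF e t']]
    by (rule integrable_continuous_real)
  have "integral I (\<lambda>t. f t' t * Heaviside (t' - t) * (a * \<phi> t + \<psi> t)) =
      integral {e..t'} (\<lambda>t. f t' t * (a * \<phi> t + \<psi> t))"
    by (rule integral_Heaviside[OF e t']) (use cd in \<open>auto simp: e_def\<close>)
  also have "\<dots> = integral {e..t'} (\<lambda>t. a * (f t' t * \<phi> t) + f t' t * \<psi> t)"
    by (simp add: algebra_simps)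
  also have "\<dots> = a * integral {e..t'} (\<lambda>t. f t' t * \<phi> t) + integral {e..t'} (\<lambda>t. f t' t * \<psi> t)"
    using int[OF \<phi>] int[OF \<psi>]
    by (simp add: Henstock_Kurzweil_Integration.integral_add integrable_on_mult_right)
  also have "integral {e..t'} (\<lambda>t. f t' t * \<phi> t) = integral I (\<lambda>t. f t' t * Heaviside (t' - t) * \<phi> t)"
    by (rule integral_Heaviside[symmetric, OF e t']) (use cd in \<open>auto simp: e_def\<close>)
  also have "integral {e..t'} (\<lambda>t. f t' t * \<psi> t) = integral I (\<lambda>t. f t' t * Heaviside (t' - t) * \<psi> t)"
    by (rule integral_Heaviside[symmetric, OF e t']) (use cd in \<open>auto simp: e_def\<close>)
  finally show "integral I (\<lambda>t. f t' t * Heaviside (t' - t) * (a * \<phi> t + \<psi> t)) =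
     a * integral I (\<lambda>t. f t' t * Heaviside (t' - t) * \<phi> t) +
     integral I (\<lambda>t. f t' t * Heaviside (t' - t) * \<psi> t)" .
qed (auto intro: test_fun_Heaviside_integral[OF f] Henstock_Kurzweil_Integration.integral_cong)

lemma test_operator_delta_distr:
  assumes f: "smooth2_on I f" shows "test_operator (delta_distr I i f)"
  unfolding delta_distr_def
proof (rule test_operator_distr_on)
  fix t' a \<phi> \<psi> assume t': "t' \<in> I" and \<phi>: "test_fun I \<phi>" and \<psi>: "test_fun I \<psi>"
  note sm = smooth_on_slice[OF f t'] test_fun_smooth[OF \<phi>] test_fun_smooth[OF \<psi>]
  have "(deriv_on I ^^ i) (\<lambda>t. f t' t * (a * \<phi> t + \<psi> t)) t' =
      (deriv_on I ^^ i) (\<lambda>t. a * (f t' t * \<phi> t) + f t' t * \<psi> t) t'"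
    by (simp add: algebra_simps)
  also have "\<dots> = a * (deriv_on I ^^ i) (\<lambda>t. f t' t * \<phi> t) t' + (deriv_on I ^^ i) (\<lambda>t. f t' t * \<psi> t) t'"
    by (simp add: funpow_deriv_on_add funpow_deriv_on_cmult smooth_on_mult smooth_on_const sm t')
  finally show "(deriv_on I ^^ i) (\<lambda>t. f t' t * (a * \<phi> t + \<psi> t)) t' =
      a * (deriv_on I ^^ i) (\<lambda>t. f t' t * \<phi> t) t' + (deriv_on I ^^ i) (\<lambda>t. f t' t * \<psi> t) t'" .
qed (auto intro: test_fun_diagonal_deriv[OF f] funpow_deriv_on_cong)

end

section \<open>The star product as composition of operators\<close>

text \<open>
  The product inserts the pairing with one factor into the other, which is composition of operators.
  For composition, everything on the left-hand factor holds without restriction.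
\<close>

lemma star_assoc: "f \<star> g \<star> h = f \<star> (g \<star> h)"
  by (simp add: star_def)

lemma star_add_left: "(f + g) \<star> h = f \<star> h + g \<star> h"
  by (simp add: star_def fun_eq_iff)

lemma star_zero_left: "0 \<star> h = 0"
  by (simp add: star_def fun_eq_iff)

lemma star_cscale_left: "cscale a f \<star> h = cscale a (f \<star> h)"
  by (simp add: star_def cscale_def fun_eq_iff)

lemma star_sum_left: "(\<Sum>i\<in>K. f i) \<star> h = (\<Sum>i\<in>K. f i \<star> h)"
  by (induction K rule: infinite_finite_induct)
    (simp_all only: sum.infinite sum.empty sum.insert star_zero_left star_add_left simp_thms)

lemma cscale_cscale: "cscale a (cscale b f) = cscale (a * b) f"
  by (simp add: cscale_def fun_eq_iff)

lemma cscale_simps: "cscale 0 f = 0" "cscale 1 f = f" "cscale a 0 = 0"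
  by (simp_all add: cscale_def fun_eq_iff)

lemma sum_cscale: "(\<Sum>i\<in>K. cscale (a i) f) = cscale (\<Sum>i\<in>K. a i) f"
  by (induction K rule: infinite_finite_induct) (auto simp: cscale_def fun_eq_iff algebra_simps)

lemma cscale_sum: "cscale a (\<Sum>i\<in>K. f i) = (\<Sum>i\<in>K. cscale a (f i))"
  by (induction K rule: infinite_finite_induct) (auto simp: cscale_def fun_eq_iff algebra_simps)

text \<open>
  The row-by-column product for rectangular matrices; it lets the Lanczos vectors be collected into an
  \<open>n \<times> N\<close> and an \<open>N \<times> n\<close> matrix.
\<close>

definition mprod :: "'k set \<Rightarrow> ('i \<Rightarrow> 'k \<Rightarrow> distr) \<Rightarrow> ('k \<Rightarrow> 'j \<Rightarrow> distr) \<Rightarrow> 'i \<Rightarrow> 'j \<Rightarrow> distr" where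
  "mprod K X Y i j = (\<Sum>k\<in>K. X i k \<star> Y k j)"

lemma mat_mat_eq_mprod: "mat_mat K X Y = mprod K X Y"
  by (simp add: mat_mat_def mprod_def fun_eq_iff)

context real_interval
begin

lemma test_operator_zero_fun:
  assumes "test_operator f" shows "f t' (\<lambda>_. 0) = 0"
  using test_operatorD(5)[OF assms test_fun_zero test_fun_zero, of t' "-1"] by simp

lemma test_operator_0 [simp, intro]: "test_operator 0"
  by (simp add: test_operator_def test_fun_zero)

lemma test_operator_cscale_add:
  assumes "test_operator f" "test_operator g" shows "test_operator (cscale a f + g)"
  unfolding test_operator_def
proof (intro conjI allI impI)
  fix \<phi> assume "test_fun I \<phi>"
  then show "test_fun I (\<lambda>t'. (cscale a f + g) t' \<phi>)"
    using test_operatorD(4)[OF assms(1)] test_operatorD(4)[OF assms(2)]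
    by (simp add: cscale_def test_fun_add test_fun_cmult)
next
  fix t' \<phi> \<psi> assume "\<forall>t\<in>I. \<phi> t = (\<psi> t :: complex)"
  then show "(cscale a f + g) t' \<phi> = (cscale a f + g) t' \<psi>"
    using assms by (simp add: cscale_def test_operatorD(3)[of f \<phi> \<psi>] test_operatorD(3)[of g \<phi> \<psi>])
next
  fix t' b \<phi> \<psi> assume "test_fun I \<phi>" "test_fun I \<psi>"
  then show "(cscale a f + g) t' (\<lambda>t. b * \<phi> t + \<psi> t) =
      b * (cscale a f + g) t' \<phi> + (cscale a f + g) t' \<psi>"
    using assms by (simp add: cscale_def test_operatorD(5)) (simp add: algebra_simps)
qed (use assms in \<open>auto simp: cscale_def test_operatorD(1,2)\<close>)

lemma test_operator_cscale [simp, intro]: "test_operator f \<Longrightarrow> test_operator (cscale a f)"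
  using test_operator_cscale_add[of f 0 a] by simp

lemma test_operator_add [simp, intro]: "test_operator f \<Longrightarrow> test_operator g \<Longrightarrow> test_operator (f + g)"
  using test_operator_cscale_add[of f g 1] by (simp add: cscale_simps)

lemma diff_eq_cscale: "f - g = cscale (- 1) g + f"
  by (simp add: cscale_def fun_eq_iff)

lemma test_operator_diff [simp, intro]: "test_operator f \<Longrightarrow> test_operator g \<Longrightarrow> test_operator (f - g)"
  by (simp add: diff_eq_cscale test_operator_cscale_add)

lemma test_operator_sum [simp, intro]:
  "(\<And>i. i \<in> K \<Longrightarrow> test_operator (f i)) \<Longrightarrow> test_operator (\<Sum>i\<in>K. f i)"
  by (induction K rule: infinite_finite_induct) auto

lemma test_operator_star [simp, intro]:
  assumes "test_operator f" "test_operator g" shows "test_operator (f \<star> g)"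
  unfolding test_operator_def star_def
proof (intro conjI allI impI)
  fix t' \<phi> assume "t' \<notin> I \<or> \<not> test_fun I \<phi>"
  then show "f t' (\<lambda>\<tau>. g \<tau> \<phi>) = 0"
    using assms test_operatorD(1)[of f] test_operatorD(2)[of g \<phi>] test_operator_zero_fun[of f] by auto
next
  fix t' \<phi> \<psi> assume "\<forall>t\<in>I. \<phi> t = (\<psi> t :: complex)"
  then show "f t' (\<lambda>\<tau>. g \<tau> \<phi>) = f t' (\<lambda>\<tau>. g \<tau> \<psi>)"
    using assms test_operatorD(3)[of g \<phi> \<psi>] by simp
next
  fix \<phi> assume "test_fun I \<phi>"
  then show "test_fun I (\<lambda>t'. f t' (\<lambda>\<tau>. g \<tau> \<phi>))"
    by (intro test_operatorD(4)[OF assms(1)] test_operatorD(4)[OF assms(2)])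
next
  fix t' a \<phi> \<psi> assume \<phi>: "test_fun I \<phi>" and \<psi>: "test_fun I \<psi>"
  have "f t' (\<lambda>\<tau>. g \<tau> (\<lambda>t. a * \<phi> t + \<psi> t)) = f t' (\<lambda>\<tau>. a * g \<tau> \<phi> + g \<tau> \<psi>)"
    by (simp add: test_operatorD(5)[OF assms(2)] \<phi> \<psi>)
  also have "\<dots> = a * f t' (\<lambda>\<tau>. g \<tau> \<phi>) + f t' (\<lambda>\<tau>. g \<tau> \<psi>)"
    by (intro test_operatorD(5)[OF assms(1)] test_operatorD(4)[OF assms(2)] \<phi> \<psi>)
  finally show "f t' (\<lambda>\<tau>. g \<tau> (\<lambda>t. a * \<phi> t + \<psi> t)) =
      a * f t' (\<lambda>\<tau>. g \<tau> \<phi>) + f t' (\<lambda>\<tau>. g \<tau> \<psi>)" .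
qed

text \<open>
  Laws that act on the right-hand factor require the left-hand one to be linear at the functions
  produced by \<open>g\<close> and \<open>h\<close>, which are test functions. If \<open>\<phi>\<close> is not one, both sides are \<open>0\<close>.
\<close>

lemma star_cscale_add_right:
  assumes "test_operator f" "test_operator g" "test_operator h"
  shows "f \<star> (cscale a g + h) = cscale a (f \<star> g) + f \<star> h"
proof (intro ext)
  fix t' \<phi>
  show "(f \<star> (cscale a g + h)) t' \<phi> = (cscale a (f \<star> g) + f \<star> h) t' \<phi>"
  proof (cases "test_fun I \<phi>")
    case True
    have "f t' (\<lambda>\<tau>. a * g \<tau> \<phi> + h \<tau> \<phi>) = a * f t' (\<lambda>\<tau>. g \<tau> \<phi>) + f t' (\<lambda>\<tau>. h \<tau> \<phi>)"
      by (intro test_operatorD(5)[OF assms(1)] test_operatorD(4)[OF assms(2)] test_operatorD(4)[OF assms(3)] True)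
    then show ?thesis by (simp add: star_def cscale_def)
  next
    case False
    then show ?thesis
      using assms by (simp add: star_def cscale_def test_operatorD(2) test_operator_zero_fun)
  qed
qed

lemma star_zero_right: "test_operator f \<Longrightarrow> f \<star> 0 = 0"
  by (simp add: star_def fun_eq_iff test_operator_zero_fun)

lemma star_add_right:
  "test_operator f \<Longrightarrow> test_operator g \<Longrightarrow> test_operator h \<Longrightarrow> f \<star> (g + h) = f \<star> g + f \<star> h"
  using star_cscale_add_right[of f g h 1] by (simp add: cscale_simps)

lemma star_cscale_right:
  "test_operator f \<Longrightarrow> test_operator g \<Longrightarrow> f \<star> cscale a g = cscale a (f \<star> g)"
  using star_cscale_add_right[of f g 0 a] by (simp add: star_zero_right)

lemma star_sum_right:
  "test_operator f \<Longrightarrow> (\<And>i. i \<in> K \<Longrightarrow> test_operator (g i)) \<Longrightarrow>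
     f \<star> (\<Sum>i\<in>K. g i) = (\<Sum>i\<in>K. f \<star> g i)"
  by (induction K rule: infinite_finite_induct)
    (simp_all only: sum.infinite sum.empty sum.insert star_zero_right star_add_right
       test_operator_sum insert_iff simp_thms)

lemma smooth2_on_const: "smooth2_on I (\<lambda>_ _. c)"
proof -
  have d: "deriv_on I (\<lambda>_. c) t = 0" if "t \<in> I" for c t
    using that by (intro deriv_on_eq has_vector_derivative_const)
  have p1: "(pd1 I ^^ i) (\<lambda>_ _. c) x y = (if i = 0 then c else 0)" if "x \<in> I" "y \<in> I" for i c x y
    using that
  proof (induction i arbitrary: x y)
    case (Suc i)
    have "(pd1 I ^^ Suc i) (\<lambda>_ _. c) x y = pd1 I (\<lambda>_ _. if i = 0 then c else 0) x y"
      unfolding funpow.simps o_apply by (rule pd_cong(1)[OF Suc.IH Suc.prems])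
    also have "\<dots> = 0"
      unfolding pd1_def by (rule d) (use Suc.prems in simp)
    finally show ?case by simp
  qed simp
  have p2: "(pd2 I ^^ j) (\<lambda>_ _. c) x y = (if j = 0 then c else 0)" if "x \<in> I" "y \<in> I" for j x y
    using that
  proof (induction j arbitrary: x y)
    case (Suc j)
    have "(pd2 I ^^ Suc j) (\<lambda>_ _. c) x y = pd2 I (\<lambda>_ _. if j = 0 then c else 0) x y"
      unfolding funpow.simps o_apply by (rule pd_cong(2)[OF Suc.IH Suc.prems])
    also have "\<dots> = 0"
      unfolding pd2_def by (rule d) (use Suc.prems in simp)
    finally show ?case by simp
  qed simp
  have eq: "(pd1 I ^^ i) ((pd2 I ^^ j) (\<lambda>_ _. c)) x y = (if i = 0 \<and> j = 0 then c else 0)"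
    if "x \<in> I" "y \<in> I" for i j x y
    using funpow_pd1_cong[where i = i, OF p2[where j = j] that] p1[OF that, of i] by simp
  show ?thesis
    unfolding smooth2_on_def Let_def
  proof (intro allI conjI ballI)
    fix i j
    show "continuous_on (I \<times> I) (\<lambda>(t', t). (pd1 I ^^ i) ((pd2 I ^^ j) (\<lambda>_ _. c)) t' t)"
      by (rule continuous_on_eq[OF continuous_on_const, of _ "if i = 0 \<and> j = 0 then c else 0"])
        (auto simp: eq)
    fix x y assume "x \<in> I" "y \<in> I"
    then show "(\<lambda>x. (pd1 I ^^ i) ((pd2 I ^^ j) (\<lambda>_ _. c)) x y) differentiable at x within I"
      "(\<lambda>y. (pd1 I ^^ i) ((pd2 I ^^ j) (\<lambda>_ _. c)) x y) differentiable at y within I"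
      by (subst differentiable_cong_I[OF eq]; simp)+
  qed
qed

lemma test_operator_star_one [simp, intro]: "test_operator (star_one I)"
  unfolding star_one_def by (rule test_operator_delta_distr[OF smooth2_on_const])

lemma star_one_apply: "star_one I t' \<phi> = (if t' \<in> I \<and> test_fun I \<phi> then \<phi> t' else 0)"
  by (simp add: star_one_def delta_distr_def distr_on_def)

lemma star_one_left [simp]: "test_operator f \<Longrightarrow> star_one I \<star> f = f"
  using test_operatorD(1,2,4)[of f] by (fastforce simp: star_def star_one_apply fun_eq_iff)

lemma star_one_right [simp]:
  assumes "test_operator f" shows "f \<star> star_one I = f"
proof (intro ext)
  fix t' \<phi>
  show "(f \<star> star_one I) t' \<phi> = f t' \<phi>"
  proof (cases "test_fun I \<phi>")
    case True
    then show ?thesis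
      unfolding star_def by (intro test_operatorD(3)[OF assms]) (simp add: star_one_apply)
  next
    case False
    then show ?thesis
      using assms by (simp add: star_def star_one_apply test_operatorD(2) test_operator_zero_fun)
  qed
qed

lemma test_operator_DI: "d \<in> DI I \<Longrightarrow> test_operator d"
  unfolding DI_def has_theta_coeff_def
  by (auto intro!: test_operator_add test_operator_sum test_operator_theta_distr test_operator_delta_distr)

lemma test_operator_Sm_Theta: "d \<in> Sm_Theta I \<Longrightarrow> test_operator d"
  unfolding Sm_Theta_def by (auto intro: test_operator_theta_distr)

lemma star_inv_eq:
  assumes "is_star_inverse I f g" shows "star_inv I f = g"
  unfolding star_inv_def
proof (rule the_equality)
  show "is_star_inverse I f g" by fact
  fix h assume h: "is_star_inverse I f h"
  have "h = h \<star> (f \<star> g)"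
    using assms h by (simp add: is_star_inverse_def test_operator_DI)
  also have "\<dots> = h \<star> f \<star> g" by (simp only: star_assoc)
  also have "\<dots> = g" using assms h by (simp add: is_star_inverse_def test_operator_DI)
  finally show "h = g" .
qed

section \<open>Matrices of test operators\<close>

lemma mprod_assoc:
  assumes "\<And>i k. test_operator (X i k)" "\<And>k l. test_operator (Y k l)" "\<And>l j. test_operator (Z l j)"
  shows "mprod L (mprod K X Y) Z = mprod K X (mprod L Y Z)"
proof (rule ext, rule ext)
  fix i j
  have "mprod L (mprod K X Y) Z i j = (\<Sum>l\<in>L. \<Sum>k\<in>K. X i k \<star> (Y k l \<star> Z l j))"
    by (simp add: mprod_def star_sum_left star_assoc)
  also have "\<dots> = (\<Sum>k\<in>K. \<Sum>l\<in>L. X i k \<star> (Y k l \<star> Z l j))"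
    by (rule sum.swap)
  also have "\<dots> = mprod K X (mprod L Y Z) i j"
    by (simp add: mprod_def star_sum_right assms)
  finally show "mprod L (mprod K X Y) Z i j = mprod K X (mprod L Y Z) i j" .
qed

lemma test_operator_mprod [simp, intro]:
  "(\<And>i k. test_operator (X i k)) \<Longrightarrow> (\<And>k j. test_operator (Y k j)) \<Longrightarrow> test_operator (mprod K X Y i j)"
  by (auto simp: mprod_def)

lemma mprod_one_left:
  assumes "finite K" "i \<in> K" "\<And>k. test_operator (Y k j)"
  shows "mprod K (mat_one I) Y i j = Y i j"
proof -
  have "mprod K (mat_one I) Y i j = (\<Sum>k\<in>K. if k = i then Y i j else 0)"
    unfolding mprod_def mat_one_def using assms by (intro sum.cong) (auto simp: star_zero_left)
  with assms show ?thesis by simp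
qed

lemma mprod_one_right:
  assumes "finite K" "j \<in> K" "\<And>k. test_operator (X i k)"
  shows "mprod K X (mat_one I) i j = X i j"
proof -
  have "mprod K X (mat_one I) i j = (\<Sum>k\<in>K. if k = j then X i j else 0)"
    unfolding mprod_def mat_one_def using assms by (intro sum.cong) (auto simp: star_zero_right)
  with assms show ?thesis by simp
qed

lemma test_operator_mat_power [simp, intro]:
  assumes "\<And>i k. test_operator (M i k)" shows "test_operator (mat_power I K M j i k)"
  using assms by (induction j arbitrary: i k) (auto simp: mat_one_def mat_mat_eq_mprod)

text \<open>
  The column \<open>l\<close> must lie in the index set, because \<open>mat_one\<close> also has its diagonal entries outside, whereas
  a product over \<open>K\<close> with \<open>mat_one\<close> on the right vanishes in columns outside \<open>K\<close>.
\<close>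

lemma mat_power_add:
  assumes M: "\<And>i k. test_operator (M i k)" and "finite K" "l \<in> K"
  shows "mat_power I K M (a + b) i l = mprod K (mat_power I K M a) (mat_power I K M b) i l"
  using \<open>l \<in> K\<close>
proof (induction b arbitrary: l)
  case 0
  then show ?case using assms by (simp add: mprod_one_right)
next
  case (Suc b)
  have "mat_power I K M (a + Suc b) i l = mprod K (mprod K (mat_power I K M a) (mat_power I K M b)) M i l"
    unfolding mprod_def[of K _ M] using Suc.IH by (simp add: mat_mat_def)
  also have "\<dots> = mprod K (mat_power I K M a) (mat_power I K M (Suc b)) i l"
    using M by (simp add: mprod_assoc mat_mat_eq_mprod)
  finally show ?case .
qed

lemma mat_power_cong:
  assumes "\<And>i k. i \<in> K \<Longrightarrow> k \<in> K \<Longrightarrow> M i k = M' i k" "i \<in> K" "k \<in> K"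
  shows "mat_power I K M j i k = mat_power I K M' j i k"
  using assms(2,3) by (induction j arbitrary: i k) (auto simp: mat_mat_def assms(1) intro!: sum.cong)

lemma mat_power_1:
  assumes "finite K" "i \<in> K" "\<And>i k. test_operator (M i k)"
  shows "mat_power I K M 1 i k = M i k"
  using assms by (simp add: mat_mat_eq_mprod mprod_one_left)

end

section \<open>Biorthogonality of the Lanczos vectors\<close>

locale star_lanczos = real_interval I for I :: "real set" +
  fixes A :: "'n::finite dmat" and w v :: "complex^'n" and n :: nat
  assumes A [simp]: "test_operator (A i k)"
    and normalized: "(\<Sum>i\<in>UNIV. cnj (w $ i) * v $ i) = 1"
    and n_pos: "0 < n"
    and no_breakdown: "no_breakdown I A w v n"
begin

abbreviation "W \<equiv> lanczos_w I A w v"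
abbreviation "V \<equiv> lanczos_v I A w v"
abbreviation "\<alpha> \<equiv> lanczos_alpha I A w v"
abbreviation "\<beta> \<equiv> lanczos_beta I A w v"
abbreviation "T \<equiv> lanczos_T I A w v"

definition pairing :: "'n dvec \<Rightarrow> 'n dvec \<Rightarrow> distr" (infix "\<bullet>\<^sub>\<star>" 75) where
  "x \<bullet>\<^sub>\<star> y = row_col UNIV x y"

definition form :: "'n dvec \<Rightarrow> 'n dvec \<Rightarrow> distr" where
  "form x y = row_mat UNIV x A \<bullet>\<^sub>\<star> y"

lemma alpha_eq: "\<alpha> k = form (W k) (V k)"
  by (simp add: lanczos_alpha_def form_def pairing_def)

lemma beta_eq: "\<beta> (Suc k) = form (W (Suc k)) (V k)"
  by (simp add: lanczos_beta_def form_def pairing_def)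

lemma pairing_add_left: "(\<lambda>i. x i + y i) \<bullet>\<^sub>\<star> z = x \<bullet>\<^sub>\<star> z + y \<bullet>\<^sub>\<star> z"
  by (simp add: pairing_def row_col_def star_add_left sum.distrib)

lemma pairing_add_right:
  assumes "\<And>i. test_operator (x i)" "\<And>i. test_operator (y i)" "\<And>i. test_operator (z i)"
  shows "x \<bullet>\<^sub>\<star> (\<lambda>i. y i + z i) = x \<bullet>\<^sub>\<star> y + x \<bullet>\<^sub>\<star> z"
  by (simp add: pairing_def row_col_def star_add_right sum.distrib assms)

lemma pairing_star_left:
  assumes "test_operator a" "\<And>i. test_operator (x i)" "\<And>i. test_operator (y i)"
  shows "(\<lambda>i. a \<star> x i) \<bullet>\<^sub>\<star> y = a \<star> (x \<bullet>\<^sub>\<star> y)"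
  by (simp add: pairing_def row_col_def star_assoc star_sum_right assms)

lemma pairing_star_right: "x \<bullet>\<^sub>\<star> (\<lambda>i. y i \<star> a) = (x \<bullet>\<^sub>\<star> y) \<star> a"
  by (simp add: pairing_def row_col_def star_assoc star_sum_left)

lemma test_operator_pairing [simp]:
  "(\<And>i. test_operator (x i)) \<Longrightarrow> (\<And>i. test_operator (y i)) \<Longrightarrow> test_operator (x \<bullet>\<^sub>\<star> y)"
  by (auto simp: pairing_def row_col_def)

lemma test_operator_row_mat [simp]:
  "(\<And>i. test_operator (x i)) \<Longrightarrow> test_operator (row_mat UNIV x A i)"
  by (auto simp: row_mat_def)

lemma test_operator_mat_col [simp]:
  "(\<And>i. test_operator (x i)) \<Longrightarrow> test_operator (mat_col UNIV A x i)"
  by (auto simp: mat_col_def)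

lemma test_operator_form [simp]:
  "(\<And>i. test_operator (x i)) \<Longrightarrow> (\<And>i. test_operator (y i)) \<Longrightarrow> test_operator (form x y)"
  by (auto simp: form_def)

lemma form_eq:
  assumes "\<And>i. test_operator (x i)" "\<And>i. test_operator (y i)"
  shows "form x y = x \<bullet>\<^sub>\<star> mat_col UNIV A y"
proof -
  have "form x y = mprod UNIV (mprod UNIV (\<lambda>_. x) A) (\<lambda>i _. y i) () ()"
    by (simp add: form_def pairing_def row_col_def row_mat_def mprod_def)
  also have "\<dots> = mprod UNIV (\<lambda>_. x) (mprod UNIV A (\<lambda>i _. y i)) () ()"
    using assms by (simp add: mprod_assoc)
  also have "\<dots> = x \<bullet>\<^sub>\<star> mat_col UNIV A y"
    by (simp add: pairing_def row_col_def mat_col_def mprod_def)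
  finally show ?thesis .
qed

text \<open>
  The algorithm divides by \<open>\<beta>\<^sub>k\<close> through a definite description, which denotes the inverse granted by the
  no-breakdown assumption because star inverses are unique.
\<close>

lemma star_inv_beta:
  assumes "Suc k < n"
  shows "test_operator (star_inv I (\<beta> (Suc k)))"
    "star_inv I (\<beta> (Suc k)) \<star> \<beta> (Suc k) = star_one I" "\<beta> (Suc k) \<star> star_inv I (\<beta> (Suc k)) = star_one I"
proof -
  obtain g where g: "is_star_inverse I (\<beta> (Suc k)) g"
    using no_breakdown assms unfolding no_breakdown_def by force
  then have "star_inv I (\<beta> (Suc k)) = g" by (rule star_inv_eq)
  with g show "test_operator (star_inv I (\<beta> (Suc k)))"
    "star_inv I (\<beta> (Suc k)) \<star> \<beta> (Suc k) = star_one I" "\<beta> (Suc k) \<star> star_inv I (\<beta> (Suc k)) = star_one I"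
    by (auto simp: is_star_inverse_def intro: test_operator_DI)
qed

declare lanczos_w.simps [simp del] lanczos_v.simps [simp del]

lemma W_Suc: "W (Suc k) i = row_mat UNIV (W k) A i - \<alpha> k \<star> W k i
    - (if k = 0 then 0 else \<beta> k \<star> W (k - 1) i)"
  by (simp add: lanczos_w.simps(2) Let_def lanczos_alpha_def lanczos_beta_def)

lemma V_Suc: "V (Suc k) i = (mat_col UNIV A (V k) i - V k i \<star> \<alpha> k
    - (if k = 0 then 0 else V (k - 1) i)) \<star> star_inv I (\<beta> (Suc k))"
  by (simp add: lanczos_v.simps(2) Let_def lanczos_alpha_def lanczos_beta_def)

lemma test_operator_W_V:
  "k < n \<Longrightarrow> (\<forall>i. test_operator (W k i)) \<and> (\<forall>i. test_operator (V k i))"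
proof (induction k rule: less_induct)
  case (less k)
  show ?case
  proof (cases k)
    case 0
    then show ?thesis by (simp add: lanczos_w.simps(1) lanczos_v.simps(1))
  next
    case (Suc m)
    have m: "test_operator (W m i)" "test_operator (V m i)" for i
      using less.IH[of m] less.prems Suc by auto
    have m1: "test_operator (W (m - 1) i)" "test_operator (V (m - 1) i)" for i
      using less.IH[of "m - 1"] less.prems Suc by auto
    have "test_operator (\<alpha> m)" using m by (simp add: alpha_eq)
    moreover have "test_operator (\<beta> m)" if "m \<noteq> 0"
      using m m1 that by (cases m) (simp_all add: beta_eq)
    ultimately have W: "test_operator (W (Suc m) i)" for i
      using m m1 by (simp add: W_Suc)
    have "test_operator (V (Suc m) i)" for i
      using m m1 star_inv_beta(1)[of m] less.prems Suc \<open>test_operator (\<alpha> m)\<close>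
      by (simp add: V_Suc)
    with W Suc show ?thesis by simp
  qed
qed

lemma test_operator_WV [simp]:
  "k < n \<Longrightarrow> test_operator (W k i)" "k < n \<Longrightarrow> test_operator (V k i)"
  using test_operator_W_V by auto

lemma test_operator_alpha_beta [simp]:
  "k < n \<Longrightarrow> test_operator (\<alpha> k)" "Suc k < n \<Longrightarrow> test_operator (\<beta> (Suc k))"
  by (simp_all add: alpha_eq beta_eq)

lemma row_recurrence:
  "row_mat UNIV (W k) A i = \<alpha> k \<star> W k i + (W (Suc k) i + (if k = 0 then 0 else \<beta> k \<star> W (k - 1) i))"
  by (simp only: W_Suc) (simp add: algebra_simps)

lemma column_recurrence:
  assumes "Suc k < n"
  shows "mat_col UNIV A (V k) i =
    V k i \<star> \<alpha> k + (V (Suc k) i \<star> \<beta> (Suc k) + (if k = 0 then 0 else V (k - 1) i))"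
proof -
  have "V (Suc k) i \<star> \<beta> (Suc k) = mat_col UNIV A (V k) i - V k i \<star> \<alpha> k
    - (if k = 0 then 0 else V (k - 1) i)"
    using assms unfolding V_Suc
    by (simp add: star_assoc star_inv_beta(2) star_one_right)
  then show ?thesis by (simp add: algebra_simps)
qed

text \<open>
  The Lanczos recurrences expand the form \<open>w\<^sub>k\<^sup>H \<star> A \<star> v\<^sub>j\<close> on either side; comparing the two expansions
  gives biorthogonality and the entries of \<open>T\<close>.
\<close>

lemma form_left:
  assumes "k < n" "j < n"
  shows "form (W k) (V j) = \<alpha> k \<star> (W k \<bullet>\<^sub>\<star> V j) + (W (Suc k) \<bullet>\<^sub>\<star> V j
    + (if k = 0 then 0 else \<beta> k \<star> (W (k - 1) \<bullet>\<^sub>\<star> V j)))"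
proof -
  have "row_mat UNIV (W k) A = (\<lambda>i. \<alpha> k \<star> W k i + (W (Suc k) i + (if k = 0 then 0 else \<beta> k \<star> W (k - 1) i)))"
    by (rule ext) (rule row_recurrence)
  then have "form (W k) (V j) = (\<lambda>i. \<alpha> k \<star> W k i) \<bullet>\<^sub>\<star> V j + (W (Suc k) \<bullet>\<^sub>\<star> V j
    + (\<lambda>i. if k = 0 then 0 else \<beta> k \<star> W (k - 1) i) \<bullet>\<^sub>\<star> V j)"
    unfolding form_def by (simp only: pairing_add_left)
  moreover have "(\<lambda>i. if k = 0 then 0 else \<beta> k \<star> W (k - 1) i) \<bullet>\<^sub>\<star> V j =
      (if k = 0 then 0 else \<beta> k \<star> (W (k - 1) \<bullet>\<^sub>\<star> V j))"
    using assms by (cases k) (simp_all add: pairing_def row_col_def star_zero_left star_assoc star_sum_right)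
  moreover have "(\<lambda>i. \<alpha> k \<star> W k i) \<bullet>\<^sub>\<star> V j = \<alpha> k \<star> (W k \<bullet>\<^sub>\<star> V j)"
    using assms by (simp add: pairing_star_left)
  ultimately show ?thesis by simp
qed

lemma form_right:
  assumes "k < n" "Suc j < n"
  shows "form (W k) (V j) = (W k \<bullet>\<^sub>\<star> V j) \<star> \<alpha> j + ((W k \<bullet>\<^sub>\<star> V (Suc j)) \<star> \<beta> (Suc j)
    + (if j = 0 then 0 else W k \<bullet>\<^sub>\<star> V (j - 1)))"
proof -
  have "mat_col UNIV A (V j) = (\<lambda>i. V j i \<star> \<alpha> j + (V (Suc j) i \<star> \<beta> (Suc j) + (if j = 0 then 0 else V (j - 1) i)))"
    using assms by (intro ext[of "mat_col UNIV A (V j)"] column_recurrence)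
  then have "form (W k) (V j) = W k \<bullet>\<^sub>\<star> (\<lambda>i. V j i \<star> \<alpha> j + (V (Suc j) i \<star> \<beta> (Suc j) + (if j = 0 then 0 else V (j - 1) i)))"
    using assms by (simp only: form_eq test_operator_WV Suc_lessD)
  also have "\<dots> = W k \<bullet>\<^sub>\<star> (\<lambda>i. V j i \<star> \<alpha> j) + (W k \<bullet>\<^sub>\<star> (\<lambda>i. V (Suc j) i \<star> \<beta> (Suc j))
      + W k \<bullet>\<^sub>\<star> (\<lambda>i. if j = 0 then 0 else V (j - 1) i))"
    using assms by (subst pairing_add_right; simp)+
  also have "W k \<bullet>\<^sub>\<star> (\<lambda>i. if j = 0 then 0 else V (j - 1) i) = (if j = 0 then 0 else W k \<bullet>\<^sub>\<star> V (j - 1))"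
    using assms by (cases j) (simp_all add: pairing_def row_col_def star_zero_right)
  finally show ?thesis by (simp only: pairing_star_right)
qed

lemma cancel_beta:
  assumes "test_operator x" "test_operator y" "x \<star> \<beta> (Suc k) = y \<star> \<beta> (Suc k)" "Suc k < n"
  shows "x = y"
proof -
  have "x = x \<star> \<beta> (Suc k) \<star> star_inv I (\<beta> (Suc k))"
    using assms(1,4) by (simp add: star_assoc star_inv_beta(3))
  also have "\<dots> = y \<star> (\<beta> (Suc k) \<star> star_inv I (\<beta> (Suc k)))"
    by (simp only: assms(3) star_assoc)
  also have "\<dots> = y"
    using assms(2,4) by (simp add: star_inv_beta(3))
  finally show ?thesis .
qed

text \<open>
  Induction on the largest index \<open>k\<close> that occurs. In the step, \<open>w\<^sub>k\<^sub>+\<^sub>1\<close> is obtained by solving the row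
  recurrence for it. Against \<open>v\<^sub>k\<close> and \<open>v\<^sub>k\<^sub>-\<^sub>1\<close> it vanishes by the choice of \<open>\<alpha>\<^sub>k\<close> and \<open>\<beta>\<^sub>k\<close>; against earlier
  \<open>v\<^sub>j\<close> because the column recurrence shows \<open>w\<^sub>k\<^sup>H \<star> A \<star> v\<^sub>j = 0\<close>. The argument for \<open>v\<^sub>k\<^sub>+\<^sub>1\<close> is symmetric, up to the
  factor \<open>\<beta>\<^sub>k\<^sub>+\<^sub>1\<close>, which is cancelled; finally \<open>\<beta>\<^sub>k\<^sub>+\<^sub>1 = w\<^sub>k\<^sub>+\<^sub>1\<^sup>H \<star> A \<star> v\<^sub>k\<close> is the factor that makes
  \<open>w\<^sub>k\<^sub>+\<^sub>1\<^sup>H \<star> v\<^sub>k\<^sub>+\<^sub>1\<close> equal to \<open>1\<^sub>\<star>\<close>.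
\<close>

lemma biorthogonality:
  "i < n \<Longrightarrow> j < n \<Longrightarrow> W i \<bullet>\<^sub>\<star> V j = (if i = j then star_one I else 0)"
proof -
  have "\<forall>i\<le>k. \<forall>j\<le>k. W i \<bullet>\<^sub>\<star> V j = (if i = j then star_one I else 0)" if "k < n" for k
    using that
  proof (induction k)
    case 0
    have "W 0 \<bullet>\<^sub>\<star> V 0 = (\<Sum>i\<in>UNIV. cscale (cnj (w $ i) * v $ i) (star_one I))"
      by (simp add: pairing_def row_col_def lanczos_w.simps(1) lanczos_v.simps(1)
          star_cscale_left cscale_cscale)
    then show ?case by (simp add: sum_cscale normalized cscale_simps)
  next
    case (Suc k)
    then have k: "k < n" "Suc k < n" by auto
    note IH = Suc.IH[OF k(1), rule_format]
    note zero = star_zero_left star_zero_right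
    have row: "W (Suc k) \<bullet>\<^sub>\<star> V j = 0" if j: "j \<le> k" for j
    proof -
      have L: "form (W k) (V j) = \<alpha> k \<star> (W k \<bullet>\<^sub>\<star> V j) + (W (Suc k) \<bullet>\<^sub>\<star> V j
          + (if k = 0 then 0 else \<beta> k \<star> (W (k - 1) \<bullet>\<^sub>\<star> V j)))"
        using j k by (intro form_left) auto
      consider "j = k" | "k = Suc j" | "Suc j < k" using j by linarith
      then show ?thesis
      proof cases
        case 1
        have "test_operator (\<beta> k)" if "k \<noteq> 0" using k that by (cases k) simp_all
        with 1 L k show ?thesis by (cases k) (simp_all add: alpha_eq[symmetric] IH zero)
      next
        case 2
        with L k show ?thesis by (simp add: beta_eq[symmetric] IH zero)
      next
        case 3
        have "form (W k) (V j) = 0"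
          using form_right[of k j] 3 k by (simp add: IH zero)
        moreover have "test_operator (\<beta> k)" using k 3 by (cases k) simp_all
        moreover have "k - Suc 0 \<noteq> j" using 3 by linarith
        ultimately show ?thesis using L 3 k by (simp add: IH zero)
      qed
    qed
    have col: "W i \<bullet>\<^sub>\<star> V (Suc k) = 0" if i: "i \<le> k" for i
    proof -
      have R: "form (W i) (V k) = (W i \<bullet>\<^sub>\<star> V k) \<star> \<alpha> k + ((W i \<bullet>\<^sub>\<star> V (Suc k)) \<star> \<beta> (Suc k)
          + (if k = 0 then 0 else W i \<bullet>\<^sub>\<star> V (k - 1)))"
        using i k by (intro form_right) auto
      have "(W i \<bullet>\<^sub>\<star> V (Suc k)) \<star> \<beta> (Suc k) = 0"
      proof -
        consider "i = k" | "k = Suc i" | "Suc i < k" using i by linarith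
        then show ?thesis
        proof cases
          case 1
          with R k show ?thesis by (cases k) (simp_all add: alpha_eq[symmetric] IH)
        next
          case 2
          have "test_operator (\<beta> i)" if "i \<noteq> 0" using k 2 that by (cases i) simp_all
          then have "form (W i) (V k) = star_one I"
            using form_left[of i k] 2 k by (simp add: IH zero)
          with R 2 k show ?thesis by (simp add: IH zero)
        next
          case 3
          have "test_operator (\<beta> i)" if "i \<noteq> 0" using k 3 that by (cases i) simp_all
          then have "form (W i) (V k) = 0"
            using form_left[of i k] 3 k by (simp add: IH zero)
          moreover have "i \<noteq> k - Suc 0" using 3 by linarith
          ultimately show ?thesis using R 3 k by (simp add: IH zero)
        qed
      qed
      then show ?thesis
        using i k by (intro cancel_beta[of _ 0 k]) (simp_all add: star_zero_left)
    qed
    have "W (Suc k) \<bullet>\<^sub>\<star> V (Suc k) = star_one I"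
    proof (rule cancel_beta[OF _ _ _ k(2)])
      show "(W (Suc k) \<bullet>\<^sub>\<star> V (Suc k)) \<star> \<beta> (Suc k) = star_one I \<star> \<beta> (Suc k)"
        using form_right[of "Suc k" k] row[of k] row[of "k - 1"] k
        by (auto simp: beta_eq[symmetric] zero split: if_splits)
    qed (use k in simp_all)
    with row col IH show ?case by (auto simp: le_Suc_eq)
  qed
  from this[of "max i j"] show "i < n \<Longrightarrow> j < n \<Longrightarrow> ?thesis" by simp
qed

text \<open>
  The diagonal and the subdiagonal are the definitions of \<open>\<alpha>\<close> and \<open>\<beta>\<close>. Above the diagonal the row
  recurrence applies, since \<open>i + 1 \<le> j < n\<close>; below the subdiagonal the column recurrence does.
\<close>

lemma form_eq_T:
  assumes "i < n" "j < n" shows "form (W i) (V j) = T i j"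
proof -
  note zero = star_zero_left star_zero_right
  have b: "test_operator (\<beta> k)" if "k \<noteq> 0" "k < n" for k using that by (cases k) simp_all
  consider "i = j" | "i = Suc j" | "j = Suc i" | "Suc i < j" | "Suc j < i" by linarith
  then show ?thesis
  proof cases
    case 3
    with form_left[OF assms] assms b[of i] show ?thesis
      by (simp add: lanczos_T_def biorthogonality zero)
  next
    case 4
    with form_left[OF assms] assms b[of i] show ?thesis
      by (simp add: lanczos_T_def biorthogonality zero)
  next
    case 5
    with form_right[of i j] assms show ?thesis
      by (simp add: lanczos_T_def biorthogonality zero)
  qed (simp_all add: lanczos_T_def alpha_eq beta_eq)
qed

end

section \<open>Matching of the moments\<close>

context star_lanczos
begin

text \<open>
  The Lanczos vectors as matrices. Padding with \<open>0\<close> outside the first \<open>n\<close> indices makes all entries test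
  operators, so that matrix products associate as functions and can be rewritten without side conditions
  on indices.
\<close>

definition WM :: "nat \<Rightarrow> 'n \<Rightarrow> distr" where
  "WM k p = (if k < n then W k p else 0)"

definition VM :: "'n \<Rightarrow> nat \<Rightarrow> distr" where
  "VM p k = (if k < n then V k p else 0)"

definition TM :: "nat \<Rightarrow> nat \<Rightarrow> distr" where
  "TM i j = (if i < n \<and> j < n then T i j else 0)"

abbreviation "PA \<equiv> mat_power I UNIV A"
abbreviation "PT \<equiv> mat_power I {..<n} TM"

lemma test_operator_WM [simp]: "test_operator (WM k p)"
  by (simp add: WM_def)

lemma test_operator_VM [simp]: "test_operator (VM p k)"
  by (simp add: VM_def)

lemma test_operator_TM [simp]: "test_operator (TM i j)"
proof -
  have "test_operator (\<beta> i)" if "i = Suc j" "i < n" using that by simp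
  then show ?thesis by (auto simp: TM_def lanczos_T_def)
qed

lemma WAV: "i < n \<Longrightarrow> j < n \<Longrightarrow> mprod UNIV WM (mprod UNIV A VM) i j = TM i j"
  using form_eq[of "W i" "V j"] form_eq_T[of i j]
  by (simp add: mprod_def WM_def VM_def TM_def pairing_def row_col_def mat_col_def)

lemma WV: "i < n \<Longrightarrow> j < n \<Longrightarrow> mprod UNIV WM VM i j = mat_one I i j"
  using biorthogonality[of i j]
  by (simp add: mprod_def WM_def VM_def pairing_def row_col_def mat_one_def)

lemma sum_tridiagonal:
  fixes g :: "nat \<Rightarrow> 'b::comm_monoid_add"
  assumes "Suc k < n" "\<And>l. l < n \<Longrightarrow> l \<noteq> k \<Longrightarrow> l \<noteq> Suc k \<Longrightarrow> k \<noteq> Suc l \<Longrightarrow> g l = 0"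
  shows "(\<Sum>l<n. g l) = g k + (g (Suc k) + (if k = 0 then 0 else g (k - 1)))"
proof -
  have "(\<Sum>l<n. g l) = (\<Sum>l\<in>(if k = 0 then {k, Suc k} else {k, Suc k, k - 1}). g l)"
  proof (rule sum.mono_neutral_right)
    show "\<forall>l\<in>{..<n} - (if k = 0 then {k, Suc k} else {k, Suc k, k - 1}). g l = 0"
      by (intro ballI assms(2)) (auto split: if_splits)
  qed (use assms(1) in auto)
  then show ?thesis by (cases k) auto
qed

text \<open>
  The row recurrence in matrix form. It does not extend to \<open>k = n - 1\<close>, where \<open>w\<^sub>n\<close> would enter.
\<close>

lemma TW_row:
  assumes "Suc k < n" shows "mprod {..<n} TM WM k p = mprod UNIV WM A k p"
proof -
  have "mprod {..<n} TM WM k p =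
      TM k k \<star> WM k p + (TM k (Suc k) \<star> WM (Suc k) p + (if k = 0 then 0 else TM k (k - 1) \<star> WM (k - 1) p))"
    unfolding mprod_def using assms
    by (intro sum_tridiagonal) (auto simp: TM_def lanczos_T_def star_zero_left)
  also have "\<dots> = row_mat UNIV (W k) A p"
    using assms unfolding row_recurrence by (cases k) (simp_all add: TM_def WM_def lanczos_T_def)
  also have "\<dots> = mprod UNIV WM A k p"
    using assms by (simp add: mprod_def row_mat_def WM_def)
  finally show ?thesis .
qed

lemma VT_column:
  assumes "Suc k < n" shows "mprod {..<n} VM TM p k = mprod UNIV A VM p k"
proof -
  have "mprod {..<n} VM TM p k =
      VM p k \<star> TM k k + (VM p (Suc k) \<star> TM (Suc k) k + (if k = 0 then 0 else VM p (k - 1) \<star> TM (k - 1) k))"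
    unfolding mprod_def using assms
    by (intro sum_tridiagonal) (auto simp: TM_def lanczos_T_def star_zero_right)
  also have "\<dots> = mat_col UNIV A (V k) p"
    using assms unfolding column_recurrence[OF assms] by (cases k) (simp_all add: TM_def VM_def lanczos_T_def)
  also have "\<dots> = mprod UNIV A VM p k"
    using assms by (simp add: mprod_def mat_col_def VM_def)
  finally show ?thesis .
qed

text \<open>
  A tridiagonal matrix moves the support of a vector by one position at a time.
\<close>

lemma PT_row_support: "l > j \<Longrightarrow> PT j 0 l = 0"
proof (induction j arbitrary: l)
  case (Suc j)
  have "PT j 0 k \<star> TM k l = 0" for k
  proof (cases "k > j")
    case False
    with Suc.prems have "TM k l = 0" by (auto simp: TM_def lanczos_T_def)
    then show ?thesis by (simp add: star_zero_right)
  next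
    case True
    show ?thesis unfolding Suc.IH[OF True] by (rule star_zero_left)
  qed
  then show ?case by (simp add: mat_mat_def)
qed (simp add: mat_one_def)

lemma PT_Suc_left:
  assumes "k < n" "l < n" shows "PT (Suc j) k l = mprod {..<n} TM (PT j) k l"
proof -
  have "PT (Suc j) k l = mprod {..<n} (PT 1) (PT j) k l"
    using mat_power_add[of TM "{..<n}" l 1 j k] assms by simp
  also have "\<dots> = mprod {..<n} TM (PT j) k l"
    using assms mat_power_1[of "{..<n}" k TM] by (simp add: mprod_def)
  finally show ?thesis .
qed

lemma PT_column_support: "l > j \<Longrightarrow> l < n \<Longrightarrow> PT j l 0 = 0"
proof (induction j arbitrary: l)
  case (Suc j)
  have "TM l k \<star> PT j k 0 = 0" if "k < n" for k
  proof (cases "k > j")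
    case False
    with Suc.prems have "TM l k = 0" by (auto simp: TM_def lanczos_T_def)
    then show ?thesis by (simp add: star_zero_left)
  next
    case True
    show ?thesis unfolding Suc.IH[OF True that] by (rule star_zero_right) simp
  qed
  then show ?case using PT_Suc_left[of l 0 j] n_pos Suc.prems by (simp add: mprod_def)
qed (simp add: mat_one_def)

text \<open>
  In the step from \<open>T\<^sup>i\<close> to \<open>T\<^sup>i\<^sup>+\<^sup>1\<close> the recurrence \<open>T W = W A\<close> is used in all rows but the last one, and there the
  first row of \<open>T\<^sup>i\<close> is zero because \<open>i < n - 1\<close>.
\<close>

lemma row_moments: "i < n \<Longrightarrow> mprod {..<n} (PT i) WM 0 p = mprod UNIV WM (PA i) 0 p"
proof (induction i arbitrary: p)
  case 0
  then show ?case by (simp add: mprod_one_left mprod_one_right)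
next
  case (Suc i)
  have "mprod {..<n} (PT (Suc i)) WM 0 p = mprod {..<n} (PT i) (mprod {..<n} TM WM) 0 p"
    by (simp add: mat_mat_eq_mprod mprod_assoc)
  also have "\<dots> = mprod {..<n} (PT i) (mprod UNIV WM A) 0 p"
    unfolding mprod_def[of _ "PT i"]
  proof (rule sum.cong)
    fix k assume "k \<in> {..<n}"
    show "PT i 0 k \<star> mprod {..<n} TM WM k p = PT i 0 k \<star> mprod UNIV WM A k p"
      using TW_row[of k p] PT_row_support[of i k] Suc.prems \<open>k \<in> {..<n}\<close>
      by (cases "Suc k < n") (auto simp: star_zero_left)
  qed simp
  also have "\<dots> = mprod UNIV (mprod {..<n} (PT i) WM) A 0 p"
    by (simp add: mprod_assoc)
  also have "\<dots> = mprod UNIV (mprod UNIV WM (PA i)) A 0 p"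
    using Suc by (simp add: mprod_def[of _ _ A])
  also have "\<dots> = mprod UNIV WM (PA (Suc i)) 0 p"
    by (simp add: mat_mat_eq_mprod mprod_assoc)
  finally show ?case .
qed

lemma column_moments: "i < n \<Longrightarrow> mprod {..<n} VM (PT i) p 0 = mprod UNIV (PA i) VM p 0"
proof (induction i arbitrary: p)
  case 0
  then show ?case by (simp add: mprod_one_left mprod_one_right)
next
  case (Suc i)
  have "mprod {..<n} VM (PT (Suc i)) p 0 = mprod {..<n} VM (mprod {..<n} TM (PT i)) p 0"
    using n_pos by (simp add: mprod_def[of _ VM] PT_Suc_left del: mat_power.simps)
  also have "\<dots> = mprod {..<n} (mprod {..<n} VM TM) (PT i) p 0"
    by (simp add: mprod_assoc)
  also have "\<dots> = mprod {..<n} (mprod UNIV A VM) (PT i) p 0"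
    unfolding mprod_def[of _ _ "PT i"]
  proof (rule sum.cong)
    fix k assume "k \<in> {..<n}"
    show "mprod {..<n} VM TM p k \<star> PT i k 0 = mprod UNIV A VM p k \<star> PT i k 0"
      using VT_column[of k p] PT_column_support[of i k] Suc.prems \<open>k \<in> {..<n}\<close>
      by (cases "Suc k < n") (auto simp: star_zero_right)
  qed simp
  also have "\<dots> = mprod UNIV A (mprod {..<n} VM (PT i)) p 0"
    by (simp add: mprod_assoc)
  also have "\<dots> = mprod UNIV A (mprod UNIV (PA i) VM) p 0"
    using Suc by (simp add: mprod_def[of _ A])
  also have "\<dots> = mprod UNIV (mprod UNIV A (PA i)) VM p 0"
    by (simp add: mprod_assoc)
  also have "mprod UNIV A (PA i) = PA (Suc i)"
  proof (rule ext, rule ext)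
    fix k l
    have "PA (Suc i) k l = mprod UNIV (PA 1) (PA i) k l"
      using mat_power_add[of A UNIV l 1 i k] by simp
    moreover have "PA 1 = A"
      using mat_power_1[of UNIV _ A] by (intro ext[of "PA 1"] ext[of "PA 1 _"]) simp
    ultimately show "mprod UNIV A (PA i) k l = PA (Suc i) k l" by simp
  qed
  finally show ?case .
qed

text \<open>
  Both factorisations reach exponent \<open>n - 1\<close>. One more power of \<open>A\<close> fits in the middle, as
  \<open>W A V\<close> is exactly \<open>T\<close>, with no exceptional row or column; this accounts for the bound \<open>2n - 1\<close>.
\<close>

lemma moment_matching:
  assumes "j \<le> 2 * n - 1"
  shows "mprod UNIV WM (mprod UNIV (PA j) VM) 0 0 = PT j 0 0"
proof -
  have "\<exists>i s l. j = i + (s + l) \<and> i < n \<and> l < n \<and> s \<le> 1"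
  proof (cases "j < n")
    case True
    then show ?thesis using n_pos by (intro exI[of _ j] exI[of _ 0]) auto
  next
    case False
    then show ?thesis using assms n_pos
      by (intro exI[of _ "n - 1"] exI[of _ 1] exI[of _ "j - n"]) auto
  qed
  then obtain i s l where j: "j = i + (s + l)" "i < n" "l < n" "s \<le> 1" by blast
  have middle: "mprod UNIV WM (mprod UNIV (PA s) VM) k m = PT s k m" if "k < n" "m < n" for k m
  proof (cases "s = 0")
    case True
    have "mprod UNIV (mat_one I) VM = VM"
      by (intro ext[of "mprod UNIV (mat_one I) VM"] ext[of "mprod UNIV (mat_one I) VM _"])
        (simp add: mprod_one_left)
    with True that show ?thesis by (simp add: WV)
  next
    case False
    with j(4) have s: "s = 1" by simp
    have "PA 1 = A"
      using mat_power_1[of UNIV _ A] by (intro ext[of "PA 1"] ext[of "PA 1 _"]) simp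
    with WAV[OF that] mat_power_1[of "{..<n}" k TM] that show ?thesis unfolding s by simp
  qed
  have "PA j = mprod UNIV (PA i) (mprod UNIV (PA s) (PA l))"
    unfolding j(1)
    by (rule ext, rule ext) (simp add: mat_power_add mprod_def[of _ "PA i"])
  then have "mprod UNIV WM (mprod UNIV (PA j) VM) 0 0 =
      mprod UNIV (mprod UNIV WM (PA i)) (mprod UNIV (PA s) (mprod UNIV (PA l) VM)) 0 0"
    by (simp add: mprod_assoc)
  also have "\<dots> = mprod UNIV (mprod {..<n} (PT i) WM) (mprod UNIV (PA s) (mprod {..<n} VM (PT l))) 0 0"
    unfolding mprod_def[of UNIV "mprod _ _ _"] mprod_def[of UNIV "PA s"]
    by (simp only: row_moments[OF j(2)] column_moments[OF j(3)])
  also have "\<dots> = mprod {..<n} (PT i) (mprod {..<n} (mprod UNIV WM (mprod UNIV (PA s) VM)) (PT l)) 0 0"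
    by (simp add: mprod_assoc)
  also have "\<dots> = mprod {..<n} (PT i) (mprod {..<n} (PT s) (PT l)) 0 0"
    by (simp add: mprod_def[of "{..<n}"] middle)
  also have "\<dots> = mprod {..<n} (PT i) (PT (s + l)) 0 0"
    using n_pos by (simp add: mprod_def[of _ "PT i"] mat_power_add)
  also have "\<dots> = PT j 0 0"
    unfolding j(1) using n_pos by (simp add: mat_power_add)
  finally show ?thesis .
qed

end

theorem theorem2p2:
  fixes I :: "real set" and At :: "real \<Rightarrow> complex^'n^'n" and v w :: "complex^'n" and n j :: nat
  defines "A \<equiv> theta_mat I At"
  assumes "is_interval I" and "interior I \<noteq> {}"
    and "\<forall>i k. A i k \<in> Sm_Theta I"
    and "(\<Sum>i\<in>UNIV. cnj (w $ i) * v $ i) = 1"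
    and "1 \<le> n" and "n \<le> CARD('n)"
    and "no_breakdown I A w v n"
    and "j \<le> 2 * n - 1"
  shows "const_form UNIV (\<lambda>i. w $ i) (mat_power I UNIV A j) (\<lambda>i. v $ i)
       = const_form {..<n} (\<lambda>i. if i = 0 then 1 else 0)
           (mat_power I {..<n} (lanczos_T I A w v) j) (\<lambda>i. if i = 0 then 1 else 0)"
proof -
  interpret real_interval I by unfold_locales fact+
  interpret star_lanczos I A w v n
    using assms by unfold_locales (auto intro: test_operator_Sm_Theta)
  have "const_form UNIV (\<lambda>i. w $ i) (PA j) (\<lambda>i. v $ i) = mprod UNIV WM (mprod UNIV (PA j) VM) 0 0"
    using n_pos
    by (simp add: const_form_def mprod_def WM_def VM_def lanczos_w.simps(1) lanczos_v.simps(1)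
        star_cscale_left star_cscale_right star_sum_right cscale_cscale cscale_sum)
  also have "\<dots> = PT j 0 0"
    by (rule moment_matching) fact
  also have "\<dots> = mat_power I {..<n} T j 0 0"
    using n_pos by (intro mat_power_cong) (auto simp: TM_def)
  also have "\<dots> = const_form {..<n} (\<lambda>i. if i = 0 then 1 else 0) (mat_power I {..<n} T j) (\<lambda>i. if i = 0 then 1 else 0)"
  proof -
    have "(\<Sum>k<n. cscale (cnj (if i = 0 then 1 else 0) * (if k = 0 then 1 else 0)) (mat_power I {..<n} T j i k)) =
        (if i = 0 then mat_power I {..<n} T j 0 0 else 0)" for i :: nat
      using n_pos by (subst sum.remove[of _ 0]) (auto simp: cscale_simps)
    then show ?thesis
      unfolding const_form_def using n_pos by (simp only: sum.delta finite_lessThan lessThan_iff if_True)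
  qed
  finally show ?thesis .
qed

end
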